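(* Let $H\in(0,1)$ be fixed, let the number of dimensions be $m=1$, and let $\delta>0$. Then the error process $\left(\int_0^t\mathcal{G}_\delta(\theta_s\omega)\,ds-\omega(t)\right)_{t\ge0}$ has stationary increments, and for any $p\ge1$ and any $t\ge0$ we have $$ \mathbb{E}\left|\int_0^t\mathcal{G}_\delta(\theta_s\omega)\,ds-\omega(t)\right|^p=\frac{2^{p/2}\,\Gamma\left(\frac{p+1}{2}\right)}{\sqrt{\pi}}\,\delta^{pH}\,\Theta^{\frac p2}\left(\frac t\delta\right), $$ where $\Gamma$ denotes the Gamma function and $$ \Theta(x)=\int_0^1\int_0^1\left[x^{2H}+2u^{2H}+|s-u+x|^{2H}-(u+x)^{2H}-|u-x|^{2H}-|u-s|^{2H}\right]ds\,du . $$
   Context: A (one-dimensional) fractional Brownian motion with Hurst index $H\in(0,1)$ is a centered Gaussian process, starting from $0$, with covariance function $R_H(s,t)=\frac12(s^{2H}+t^{2H}-|t-s|^{2H})$ for $s,t\ge0$. We work with its canonical version: $\Omega=C_0(\mathbb{R};\mathbb{R})$ is the space of continuous paths vanishing at zero with the compact open topology, $\mathcal{F}$ is its Borel $\sigma$-algebra, and $\mathbb{P}^H$ is the law of the (two-sided) fractional Brownian motion, so that the coordinate path $\omega(\cdot)$ is a fractional Brownian motion under $\mathbb{P}^H$; $\mathbb{E}$ is expectation under $\mathbb{P}^H$. The Wiener shift is $\theta_t\omega(\cdot)=\omega(\cdot+t)-\omega(t)$. For $\delta>0$, $\mathcal{G}_\delta(\omega)=\frac1\delta\omega(\delta)$,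 so that $\mathcal{G}_\delta(\theta_t\omega)=\frac1\delta(\omega(t+\delta)-\omega(t))$. *)

theory Defs
  imports "HOL-Probability.Probability"
begin

section \<open>Gaussian processes and fractional Brownian motion\<close>

(* The degenerate (a.s. constant) case is a normal law of variance 0. *)
definition gaussian_rv :: "'w measure \<Rightarrow> ('w \<Rightarrow> real) \<Rightarrow> bool" where
  "gaussian_rv M X \<longleftrightarrow> X \<in> borel_measurable M \<and>
     (\<exists>\<mu>. (AE w in M. X w = \<mu>) \<or>
          (\<exists>\<sigma>>0. distributed M lborel X (\<lambda>x. ennreal (normal_density \<mu> \<sigma> x))))"

definition gaussian_process :: "'w measure \<Rightarrow> 'i set \<Rightarrow> ('i \<Rightarrow> 'w \<Rightarrow> real) \<Rightarrow> bool" where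
  "gaussian_process M I X \<longleftrightarrow>
     (\<forall>J (a :: 'i \<Rightarrow> real). finite J \<and> J \<subseteq> I \<longrightarrow> gaussian_rv M (\<lambda>w. \<Sum>i\<in>J. a i * X i w))"

definition covariance :: "'w measure \<Rightarrow> ('w \<Rightarrow> real) \<Rightarrow> ('w \<Rightarrow> real) \<Rightarrow> real" where
  "covariance M X Y =
     integral\<^sup>L M (\<lambda>w. (X w - integral\<^sup>L M X) * (Y w - integral\<^sup>L M Y))"

(* Two-sided version: for s, t >= 0 this is (s^2H + t^2H - |t - s|^2H) / 2.
   Since 0 powr a = 0, the value 0^(2H) is correct. *)
definition fbm_cov :: "real \<Rightarrow> real \<Rightarrow> real \<Rightarrow> real" where
  "fbm_cov H s t =
     (\<bar>s\<bar> powr (2 * H) + \<bar>t\<bar> powr (2 * H) - \<bar>t - s\<bar> powr (2 * H)) / 2"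

definition two_sided_fbm :: "real \<Rightarrow> 'w measure \<Rightarrow> (real \<Rightarrow> 'w \<Rightarrow> real) \<Rightarrow> bool" where
  "two_sided_fbm H M B \<longleftrightarrow>
     prob_space M \<and>
     gaussian_process M UNIV B \<and>
     (\<forall>t. integral\<^sup>L M (B t) = 0) \<and>
     (AE w in M. B 0 w = 0) \<and>
     (\<forall>s t. covariance M (B s) (B t) = fbm_cov H s t)"

section \<open>The canonical path space\<close>

definition C0 :: "(real \<Rightarrow> real) set" where
  "C0 = {\<omega>. continuous_on UNIV \<omega> \<and> \<omega> 0 = 0}"

definition C0_topology :: "(real \<Rightarrow> real) topology" where
  "C0_topology =
     topology_generated_by {{\<omega> \<in> C0. \<omega> ` K \<subseteq> U} |K U. compact K \<and> open U}"

lemma topspace_C0_topology: "topspace C0_topology = C0"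
proof -
  have "C0 \<in> {{\<omega> \<in> C0. \<omega> ` K \<subseteq> U} |K U. compact K \<and> open U}"
    by (rule CollectI, rule exI[of _ "{}"], rule exI[of _ UNIV]) auto
  then have "\<Union>{{\<omega> \<in> C0. \<omega> ` K \<subseteq> U} |K U. compact K \<and> open U} = C0"
    by blast
  then show ?thesis
    by (simp only: C0_topology_def topology_generated_by_topspace)
qed

definition C0_borel :: "(real \<Rightarrow> real) measure" where
  "C0_borel = sigma C0 {A. openin C0_topology A}"

(* P is the law on C0 of the two-sided fractional Brownian motion; this determines P, because
   the coordinate maps generate the Borel sigma-algebra of C0. *)
definition fbm_law :: "real \<Rightarrow> (real \<Rightarrow> real) measure \<Rightarrow> bool" where
  "fbm_law H P \<longleftrightarrow>
     space P = C0 \<and> sets P = sets C0_borel \<and> two_sided_fbm H P (\<lambda>t \<omega>. \<omega> t)"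

definition wiener_shift :: "real \<Rightarrow> (real \<Rightarrow> real) \<Rightarrow> (real \<Rightarrow> real)" where
  "wiener_shift t \<omega> = (\<lambda>s. \<omega> (s + t) - \<omega> t)"

definition noise :: "real \<Rightarrow> (real \<Rightarrow> real) \<Rightarrow> real" where
  "noise \<delta> \<omega> = 1 / \<delta> * \<omega> \<delta>"

definition error_process :: "real \<Rightarrow> real \<Rightarrow> (real \<Rightarrow> real) \<Rightarrow> real" where
  "error_process \<delta> t \<omega> = integral {0..t} (\<lambda>s. noise \<delta> (wiener_shift s \<omega>)) - \<omega> t"

section \<open>Stationary increments\<close>

(* Processes indexed by [0, \<infinity>); equality of all finite-dimensional laws of
   (X (t + h) - X h) and (X t - X 0).  Measurability is part of the definition because
   distr is only meaningful for measurable maps. *)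
definition stationary_increments :: "'w measure \<Rightarrow> (real \<Rightarrow> 'w \<Rightarrow> real) \<Rightarrow> bool" where
  "stationary_increments M X \<longleftrightarrow>
     (\<forall>t\<ge>0. X t \<in> borel_measurable M) \<and>
     (\<forall>h\<ge>0. \<forall>J. finite J \<and> J \<subseteq> {0..} \<longrightarrow>
        distr M (PiM J (\<lambda>_. borel)) (\<lambda>w. \<lambda>t\<in>J. X (t + h) w - X h w) =
        distr M (PiM J (\<lambda>_. borel)) (\<lambda>w. \<lambda>t\<in>J. X t w - X 0 w))"

definition Theta :: "real \<Rightarrow> real \<Rightarrow> real" where
  "Theta H x = integral {0..1} (\<lambda>u. integral {0..1} (\<lambda>s.
     x powr (2 * H) + 2 * u powr (2 * H) + \<bar>s - u + x\<bar> powr (2 * H)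
     - (u + x) powr (2 * H) - \<bar>u - x\<bar> powr (2 * H) - \<bar>u - s\<bar> powr (2 * H)))"

end

theory Submission
  imports Defs
begin

text \<open>
  Every finite linear combination \<open>F\<close> of coordinates of the path is centered Gaussian, with
  characteristic function \<open>exp (- s\<^sup>2 * E[F\<^sup>2] / 2)\<close>.  Substituting in the integral gives
  \<open>error_process \<delta> t \<omega> = integral {0..1} (\<lambda>u. \<omega> (t + \<delta> * u) - \<omega> (\<delta> * u) - \<omega> t)\<close>
  (\<open>error_process_eq_integral\<close>).  As paths are continuous, the error is the pathwise limit of Riemann
  sums, which are such linear combinations, and characteristic functions pass to the limit by
  dominated convergence.

  Stationarity of the increments.  The increment of the error process from \<open>h\<close> to \<open>t + h\<close> is the error
  at time \<open>t\<close> of the path shifted by \<open>h\<close>, and the shifted path is again a fractional Brownian motion.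
  Two such motions give the same characteristic function to every linear combination of pathwise
  limits of finite functionals, since those of finite functionals depend on the covariance
  only.  By the Cramer--Wold device the joint laws agree (\<open>law_limit_functionals_cong\<close>).

  Moments.  By self-similarity, the second moment of the Riemann sum with \<open>n\<close> terms is
  \<open>\<delta> powr (2 * H)\<close> times a double Riemann sum of the integrand of \<open>Theta H (t / \<delta>)\<close>
  (\<open>error_riemann_second_moment\<close>), and so converges to
  \<open>v = \<delta> powr (2 * H) * Theta H (t / \<delta>)\<close>.  Hence the error is centered normal with variance \<open>v\<close>,
  and its absolute moments are those of the standard normal law, a Gamma integral, times
  \<open>v powr (p / 2)\<close> (\<open>abs_moment_centered_normal_char\<close>).
\<close>

section \<open>Characteristic functions and joint laws\<close>

text \<open>
  Uniqueness of characteristic functions for finite measures: the law of a random variable under a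
  nonnegative integrable weight is determined by its Fourier transform.  After division by the
  total mass this is Levy's theorem for probability laws.
\<close>

lemma weighted_law_eqI:
  fixes X :: "'a \<Rightarrow> real" and Y :: "'b \<Rightarrow> real"
  assumes X[measurable]: "X \<in> borel_measurable M" and Y[measurable]: "Y \<in> borel_measurable N"
    and w: "integrable M w" "\<And>x. 0 \<le> w x" and v: "integrable N v" "\<And>y. 0 \<le> v y"
    and eq: "\<And>s::real. (CLINT x|M. w x *\<^sub>R iexp (s * X x)) = (CLINT y|N. v y *\<^sub>R iexp (s * Y y))"
    and A[measurable]: "A \<in> sets borel"
  shows "(LINT x|M. w x * indicator A (X x)) = (LINT y|N. v y * indicator A (Y y))"
proof -
  define m where "m = integral\<^sup>L M w"
  have [measurable]: "w \<in> borel_measurable M" "v \<in> borel_measurable N"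
    using w v by auto
  have m_v: "m = integral\<^sup>L N v"
    using eq[of 0] by (simp add: scaleR_conv_of_real m_def)
  have "0 \<le> m"
    unfolding m_def using w(2) by simp
  show ?thesis
  proof (cases "m = 0")
    case True
    have "AE x in M. w x = 0" "AE y in N. v y = 0"
      using True integral_nonneg_eq_0_iff_AE[OF w(1)] integral_nonneg_eq_0_iff_AE[OF v(1)] w(2) v(2)
      by (auto simp: m_def m_v[unfolded m_def])
    then have "(LINT x|M. w x * indicator A (X x)) = 0" "(LINT y|N. v y * indicator A (Y y)) = 0"
      by (auto intro!: integral_eq_zero_AE)
    then show ?thesis by simp
  next
    case False
    with \<open>0 \<le> m\<close> have "0 < m" by simp
    define \<mu> where "\<mu> = distr (density M (\<lambda>x. ennreal (w x / m))) borel X"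
    define \<nu> where "\<nu> = distr (density N (\<lambda>y. ennreal (v y / m))) borel Y"
    have "(\<integral>\<^sup>+x. ennreal (w x / m) \<partial>M) = 1"
      using w \<open>0 < m\<close> by (subst nn_integral_eq_integral) (auto simp: m_def)
    then have "prob_space (density M (\<lambda>x. ennreal (w x / m)))"
      by (intro prob_spaceI) (simp add: emeasure_density cong: nn_integral_cong)
    then interpret m1: prob_space "density M (\<lambda>x. ennreal (w x / m))" .
    have "(\<integral>\<^sup>+x. ennreal (v x / m) \<partial>N) = 1"
      using v \<open>0 < m\<close> by (subst nn_integral_eq_integral) (auto simp: m_v)
    then have "prob_space (density N (\<lambda>x. ennreal (v x / m)))"
      by (intro prob_spaceI) (simp add: emeasure_density cong: nn_integral_cong)
    then interpret n1: prob_space "density N (\<lambda>x. ennreal (v x / m))" .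
    have "real_distribution \<mu>" "real_distribution \<nu>"
      unfolding \<mu>_def \<nu>_def
      by (auto simp: m1.real_distribution_distr n1.real_distribution_distr)
    moreover have "char \<mu> = char \<nu>"
    proof
      fix s
      have "char \<mu> s = (CLINT x|M. (w x / m) *\<^sub>R iexp (s * X x))"
        unfolding char_def \<mu>_def using w(2) \<open>0 < m\<close>
        by (subst integral_distr, simp, simp, subst integral_density) auto
      also have "\<dots> = (CLINT x|M. w x *\<^sub>R iexp (s * X x)) / m"
        by (simp add: scaleR_conv_of_real)
      also have "\<dots> = (CLINT y|N. v y *\<^sub>R iexp (s * Y y)) / m"
        by (simp only: eq)
      also have "\<dots> = (CLINT y|N. (v y / m) *\<^sub>R iexp (s * Y y))"
        by (simp add: scaleR_conv_of_real)
      also have "\<dots> = char \<nu> s"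
        unfolding char_def \<nu>_def using v(2) \<open>0 < m\<close>
        by (subst integral_distr, simp, simp, subst integral_density) auto
      finally show "char \<mu> s = char \<nu> s" .
    qed
    ultimately have "\<mu> = \<nu>"
      by (rule Levy_uniqueness)
    then have "(LINT z|\<mu>. indicator A z :: real) = (LINT z|\<nu>. indicator A z)"
      by simp
    moreover have "(LINT z|\<mu>. indicator A z :: real) = (LINT x|M. w x * indicator A (X x)) / m"
      unfolding \<mu>_def using w(2) \<open>0 < m\<close>
      by (subst integral_distr, simp, simp, subst integral_density) auto
    moreover have "(LINT z|\<nu>. indicator A z :: real) = (LINT y|N. v y * indicator A (Y y)) / m"
      unfolding \<nu>_def using v(2) \<open>0 < m\<close>
      by (subst integral_distr, simp, simp, subst integral_density) auto
    ultimately show ?thesis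
      using \<open>0 < m\<close> by simp
  qed
qed

text \<open>
  The weight may also be complex and bounded by 1.  Its real part is made nonnegative by adding
  \<open>1\<close>, which is harmless because \<open>X\<close> and \<open>Y\<close> have the same characteristic function.
\<close>

lemma indicator_transfer_Re:
  fixes X :: "'a \<Rightarrow> real" and Y :: "'b \<Rightarrow> real"
  assumes M: "prob_space M" and N: "prob_space N"
    and X[measurable]: "X \<in> borel_measurable M" and Y[measurable]: "Y \<in> borel_measurable N"
    and \<phi>[measurable]: "\<phi> \<in> borel_measurable M" and \<psi>[measurable]: "\<psi> \<in> borel_measurable N"
    and \<phi>1: "\<And>x. cmod (\<phi> x) \<le> 1" and \<psi>1: "\<And>y. cmod (\<psi> y) \<le> 1"
    and eq1: "\<And>s::real. (CLINT x|M. iexp (s * X x)) = (CLINT y|N. iexp (s * Y y))"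
    and eq: "\<And>s::real. (CLINT x|M. \<phi> x * iexp (s * X x)) = (CLINT y|N. \<psi> y * iexp (s * Y y))"
    and A[measurable]: "A \<in> sets borel"
  shows "(LINT x|M. Re (\<phi> x) * indicator A (X x)) = (LINT y|N. Re (\<psi> y) * indicator A (Y y))"
proof -
  interpret M: prob_space M by fact
  interpret N: prob_space N by fact
  have Re1: "\<bar>Re (\<phi> x)\<bar> \<le> 1" "\<bar>Re (\<psi> y)\<bar> \<le> 1" for x y
    using abs_Re_le_cmod[of "\<phi> x"] abs_Re_le_cmod[of "\<psi> y"] \<phi>1[of x] \<psi>1[of y] by linarith+
  then have nn: "0 \<le> 1 + Re (\<phi> x)" "0 \<le> 1 + Re (\<psi> y)" for x y
    using abs_le_D2[of "Re (\<phi> x)" 1] abs_le_D2[of "Re (\<psi> y)" 1] by (auto simp: field_simps)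
  have iM: "integrable M (\<lambda>x. f x)"
    if [measurable]: "f \<in> borel_measurable M" and "\<And>x. cmod (f x) \<le> 1"
    for f :: "'a \<Rightarrow> complex"
    by (rule M.integrable_const_bound[where B = 1]) (use that in auto)
  have iN: "integrable N (\<lambda>x. f x)"
    if [measurable]: "f \<in> borel_measurable N" and "\<And>x. cmod (f x) \<le> 1"
    for f :: "'b \<Rightarrow> complex"
    by (rule N.integrable_const_bound[where B = 1]) (use that in auto)
  have iMr: "integrable M (\<lambda>x. f x)"
    if [measurable]: "f \<in> borel_measurable M" and "\<And>x. \<bar>f x\<bar> \<le> 1"
    for f :: "'a \<Rightarrow> real"
    by (rule M.integrable_const_bound[where B = 1]) (use that in auto)
  have iNr: "integrable N (\<lambda>x. f x)"
    if [measurable]: "f \<in> borel_measurable N" and "\<And>x. \<bar>f x\<bar> \<le> 1"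
    for f :: "'b \<Rightarrow> real"
    by (rule N.integrable_const_bound[where B = 1]) (use that in auto)
  \<comment> \<open>Conjugation turns the frequency \<open>-s\<close> into \<open>s\<close>, so the conjugate weights satisfy the same identity.\<close>
  have eqc: "(CLINT x|M. cnj (\<phi> x) * iexp (s * X x)) = (CLINT y|N. cnj (\<psi> y) * iexp (s * Y y))" for s
  proof -
    have c: "cnj z * iexp (s * r) = cnj (z * iexp (- s * r))" for z r
      by (simp add: exp_cnj)
    show ?thesis
      unfolding c Bochner_Integration.integral_cnj eq ..
  qed
  have W: "(CLINT x|M. (1 + Re (\<phi> x)) *\<^sub>R iexp (s * X x)) =
      (CLINT y|N. (1 + Re (\<psi> y)) *\<^sub>R iexp (s * Y y))" for s
  proof -
    have Re_eq: "(1 + Re z) *\<^sub>R e = e + (z * e + cnj z * e) / 2" for z e :: complex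
      by (simp add: scaleR_conv_of_real complex_eq_iff algebra_simps)
    have split: "(CLINT x|L. e x + (f x + g x) / 2) = (CLINT x|L. e x) + ((CLINT x|L. f x) + (CLINT x|L. g x)) / 2"
      if "integrable L e" "integrable L f" "integrable L g" for L and e f g :: "'c \<Rightarrow> complex"
      using that by simp
    have [measurable]: "cnj \<in> borel_measurable borel"
      by (intro borel_measurable_continuous_onI continuous_intros)
    have "(CLINT x|M. (1 + Re (\<phi> x)) *\<^sub>R iexp (s * X x)) =
        (CLINT x|M. iexp (s * X x)) +
        ((CLINT x|M. \<phi> x * iexp (s * X x)) + (CLINT x|M. cnj (\<phi> x) * iexp (s * X x))) / 2"
      unfolding Re_eq by (intro split iM) (auto simp: norm_mult \<phi>1)
    also have "\<dots> = (CLINT y|N. (1 + Re (\<psi> y)) *\<^sub>R iexp (s * Y y))"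
      unfolding Re_eq eq1 eq eqc by (intro split[symmetric] iN) (auto simp: norm_mult \<psi>1)
    finally show ?thesis .
  qed
  have "(LINT x|M. (1 + Re (\<phi> x)) * indicator A (X x)) = (LINT y|N. (1 + Re (\<psi> y)) * indicator A (Y y))"
  proof (rule weighted_law_eqI[OF X Y _ nn(1) _ nn(2) W A])
    show "integrable M (\<lambda>x. 1 + Re (\<phi> x))" "integrable N (\<lambda>y. 1 + Re (\<psi> y))"
      by (intro Bochner_Integration.integrable_add M.integrable_const N.integrable_const iMr iNr Re1; simp)+
  qed
  moreover have "(LINT x|M. (1 + Re (\<phi> x)) * indicator A (X x)) =
      (LINT x|M. indicator A (X x)) + (LINT x|M. Re (\<phi> x) * indicator A (X x))"
    unfolding distrib_right using Re1
    by (subst Bochner_Integration.integral_add) (auto intro!: iMr simp: abs_mult split: split_indicator)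
  moreover have "(LINT x|N. (1 + Re (\<psi> x)) * indicator A (Y x)) =
      (LINT x|N. indicator A (Y x)) + (LINT x|N. Re (\<psi> x) * indicator A (Y x))"
    unfolding distrib_right using Re1
    by (subst Bochner_Integration.integral_add) (auto intro!: iNr simp: abs_mult split: split_indicator)
  moreover have "(LINT x|M. 1 * indicator A (X x)) = (LINT y|N. 1 * indicator A (Y y) :: real)"
  proof (rule weighted_law_eqI[OF X Y])
    show "(CLINT x|M. 1 *\<^sub>R iexp (s * X x)) = (CLINT y|N. 1 *\<^sub>R iexp (s * Y y))" for s
      using eq1[of s] by simp
  qed auto
  ultimately show ?thesis by simp
qed

lemma indicator_transfer:
  fixes X :: "'a \<Rightarrow> real" and Y :: "'b \<Rightarrow> real"
  assumes M: "prob_space M" and N: "prob_space N"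
    and X[measurable]: "X \<in> borel_measurable M" and Y[measurable]: "Y \<in> borel_measurable N"
    and \<phi>[measurable]: "\<phi> \<in> borel_measurable M" and \<psi>[measurable]: "\<psi> \<in> borel_measurable N"
    and \<phi>1: "\<And>x. cmod (\<phi> x) \<le> 1" and \<psi>1: "\<And>y. cmod (\<psi> y) \<le> 1"
    and eq1: "\<And>s::real. (CLINT x|M. iexp (s * X x)) = (CLINT y|N. iexp (s * Y y))"
    and eq: "\<And>s::real. (CLINT x|M. \<phi> x * iexp (s * X x)) = (CLINT y|N. \<psi> y * iexp (s * Y y))"
    and A[measurable]: "A \<in> sets borel"
  shows "(CLINT x|M. \<phi> x * indicator A (X x)) = (CLINT y|N. \<psi> y * indicator A (Y y))"
proof (rule complex_eqI)
  interpret M: prob_space M by fact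
  interpret N: prob_space N by fact
  have iM: "integrable M (\<lambda>x. \<phi> x * indicator A (X x))"
    by (rule M.integrable_const_bound[where B = 1]) (use \<phi>1 in \<open>auto simp: norm_mult split: split_indicator\<close>)
  have iN: "integrable N (\<lambda>x. \<psi> x * indicator A (Y x))"
    by (rule N.integrable_const_bound[where B = 1]) (use \<psi>1 in \<open>auto simp: norm_mult split: split_indicator\<close>)
  have ind: "(indicator A x :: complex) = of_real (indicator A x)" for x :: real
    by (simp split: split_indicator)
  have "(LINT x|M. Re (\<phi> x) * indicator A (X x)) = (LINT y|N. Re (\<psi> y) * indicator A (Y y))"
    by (rule indicator_transfer_Re[OF assms]) 
  then show "Re (CLINT x|M. \<phi> x * indicator A (X x)) = Re (CLINT y|N. \<psi> y * indicator A (Y y))"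
    using iM iN by (simp flip: integral_Re) (simp add: ind)
  have "(LINT x|M. Re (- \<i> * \<phi> x) * indicator A (X x)) = (LINT y|N. Re (- \<i> * \<psi> y) * indicator A (Y y))"
  proof (rule indicator_transfer_Re[OF M N X Y _ _ _ _ eq1 _ A])
    show "(CLINT x|M. (- \<i> * \<phi> x) * iexp (s * X x)) = (CLINT y|N. (- \<i> * \<psi> y) * iexp (s * Y y))" for s
      unfolding mult.assoc integral_mult_right_zero eq ..
  qed (use \<phi>1 \<psi>1 in \<open>auto simp: norm_mult\<close>)
  then show "Im (CLINT x|M. \<phi> x * indicator A (X x)) = Im (CLINT y|N. \<psi> y * indicator A (Y y))"
    using iM iN by (simp flip: integral_Im) (simp add: ind)
qed

text \<open>
  The Cramer--Wold device: a finite-dimensional law is determined by the characteristic functions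
  of all linear combinations of the coordinates.
\<close>

lemma Cramer_Wold:
  fixes X :: "'i \<Rightarrow> 'a \<Rightarrow> real" and Y :: "'i \<Rightarrow> 'b \<Rightarrow> real"
  assumes M: "prob_space M" and N: "prob_space N" and "finite J"
    and X: "\<And>j. j \<in> J \<Longrightarrow> X j \<in> borel_measurable M"
    and Y: "\<And>j. j \<in> J \<Longrightarrow> Y j \<in> borel_measurable N"
    and eq: "\<And>a. (CLINT x|M. iexp (\<Sum>j\<in>J. a j * X j x)) = (CLINT y|N. iexp (\<Sum>j\<in>J. a j * Y j y))"
  shows "distr M (PiM J (\<lambda>_. borel)) (\<lambda>x. \<lambda>j\<in>J. X j x) = distr N (PiM J (\<lambda>_. borel)) (\<lambda>y. \<lambda>j\<in>J. Y j y)"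
proof -
  interpret M: prob_space M by fact
  interpret N: prob_space N by fact
  have mX: "(\<lambda>x. \<lambda>j\<in>J. X j x) \<in> measurable M (PiM J (\<lambda>_. borel))"
    using X by (rule measurable_restrict)
  have mY: "(\<lambda>x. \<lambda>j\<in>J. Y j x) \<in> measurable N (PiM J (\<lambda>_. borel))"
    using Y by (rule measurable_restrict)
  have upd: "(\<Sum>j\<in>J. (a(k := a k + s)) j * Z j) = (\<Sum>j\<in>J. a j * Z j) + s * Z k"
    if "k \<in> J" for a Z :: "'i \<Rightarrow> real" and k s
  proof -
    have "(\<Sum>j\<in>J. (a(k := a k + s)) j * Z j) = (\<Sum>j\<in>J. a j * Z j + (if j = k then s * Z k else 0))"
      by (rule sum.cong) (auto simp: algebra_simps)
    then show ?thesis
      using \<open>finite J\<close> that by (simp add: sum.distrib)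
  qed
  \<comment> \<open>The coordinates in \<open>K\<close> have been converted from frequencies to indicators of Borel sets; the
    induction converts one more coordinate \<open>k\<close>, shifting its frequency by \<open>s\<close> to vary it freely.\<close>
  have main: "(CLINT x|M. (\<Prod>i\<in>K. indicator (A i) (X i x)) * iexp (\<Sum>j\<in>J. a j * X j x)) =
      (CLINT y|N. (\<Prod>i\<in>K. indicator (A i) (Y i y)) * iexp (\<Sum>j\<in>J. a j * Y j y))"
    if "K \<subseteq> J" and A: "\<And>i. i \<in> J \<Longrightarrow> A i \<in> sets borel" for K A a
  proof -
    have "finite K" using that \<open>finite J\<close> finite_subset by blast
    then show ?thesis using \<open>K \<subseteq> J\<close>
    proof (induction K arbitrary: a rule: finite_induct)
      case empty
      then show ?case using eq[of a] by simp
    next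
      case (insert k K)
      then have k: "k \<in> J" and K: "\<And>i. i \<in> K \<Longrightarrow> i \<in> J" and "K \<subseteq> J" by auto
      define \<phi> where "\<phi> x = (\<Prod>i\<in>K. indicator (A i) (X i x)) * iexp (\<Sum>j\<in>J. a j * X j x)" for x
      define \<psi> where "\<psi> y = (\<Prod>i\<in>K. indicator (A i) (Y i y)) * iexp (\<Sum>j\<in>J. a j * Y j y)" for y
      have ind: "(\<lambda>x. indicator (A i) (Z i x) :: complex) \<in> borel_measurable L"
        if "i \<in> J" "Z i \<in> borel_measurable L" for i L and Z :: "'i \<Rightarrow> 'c \<Rightarrow> real"
        using measurable_compose[OF that(2) borel_measurable_indicator[OF A[OF that(1)]]] .
      have iexp_meas: "(\<lambda>x. iexp (\<Sum>j\<in>J. a j * Z j x)) \<in> borel_measurable L"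
        if "\<And>j. j \<in> J \<Longrightarrow> Z j \<in> borel_measurable L" for L and Z :: "'i \<Rightarrow> 'c \<Rightarrow> real"
      proof -
        have "(\<lambda>x. \<Sum>j\<in>J. a j * Z j x) \<in> borel_measurable L"
          using that by (intro borel_measurable_sum borel_measurable_times borel_measurable_const)
        from measurable_compose[OF this, of iexp borel] show ?thesis by simp
      qed
      have m1: "\<phi> \<in> borel_measurable M"
        unfolding \<phi>_def
        by (intro borel_measurable_times borel_measurable_prod ind X iexp_meas) (auto dest: K)
      have m2: "\<psi> \<in> borel_measurable N"
        unfolding \<psi>_def
        by (intro borel_measurable_times borel_measurable_prod ind Y iexp_meas) (auto dest: K)
      have p: "cmod (\<Prod>i\<in>K. indicator (A i) (z i)) \<le> 1" for z
        unfolding prod_norm[symmetric] by (rule prod_le_1) (auto split: split_indicator)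
      have b: "cmod (\<phi> x) \<le> 1" "cmod (\<psi> y) \<le> 1" for x y
        by (auto simp: \<phi>_def \<psi>_def norm_mult p)
      have e: "iexp (\<Sum>j\<in>J. (a(k := a k + s)) j * Z j) = iexp (\<Sum>j\<in>J. a j * Z j) * iexp (s * Z k)"
        for Z s
        unfolding upd[OF k] by (simp add: distrib_left exp_add)
      have single: "(\<Sum>j\<in>J. ((\<lambda>_. 0)(k := s)) j * Z j) = s * Z k" for s and Z :: "'i \<Rightarrow> real"
        using upd[OF k, of "\<lambda>_. 0" s Z] by simp
      have "(CLINT x|M. \<phi> x * indicator (A k) (X k x)) = (CLINT y|N. \<psi> y * indicator (A k) (Y k y))"
      proof (rule indicator_transfer[OF M N X[OF k] Y[OF k] m1 m2 b])
        fix s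
        show "(CLINT x|M. iexp (s * X k x)) = (CLINT y|N. iexp (s * Y k y))"
          using eq[of "(\<lambda>_. 0)(k := s)"] unfolding single .
        show "(CLINT x|M. \<phi> x * iexp (s * X k x)) = (CLINT y|N. \<psi> y * iexp (s * Y k y))"
          using insert.IH[OF \<open>K \<subseteq> J\<close>, of "a(k := a k + s)"]
          unfolding e \<phi>_def \<psi>_def by (simp add: mult.assoc)
      qed (use A[OF k] in auto)
      then show ?case
        using insert.hyps by (simp add: \<phi>_def \<psi>_def ac_simps)
    qed
  qed
  show ?thesis
  proof (rule measure_eqI_PiM_finite[OF \<open>finite J\<close>])
    fix A :: "'i \<Rightarrow> real set" assume A: "\<And>i. i \<in> J \<Longrightarrow> A i \<in> sets borel"
    have PA: "Pi\<^sub>E J A \<in> sets (PiM J (\<lambda>_. borel))"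
      using \<open>finite J\<close> A by (intro sets_PiM_I_finite) auto
    have pr: "(\<Prod>i\<in>J. indicator (A i) (z i)) = (of_real (indicator (Pi\<^sub>E J A) (\<lambda>j\<in>J. z j)) :: complex)" for z
    proof (cases "\<forall>i\<in>J. z i \<in> A i")
      case False
      then obtain i where "i \<in> J" "z i \<notin> A i" by auto
      then show ?thesis
        using \<open>finite J\<close> by (subst prod_zero) (auto simp: indicator_def)
    qed (auto simp: indicator_def PiE_iff)
    have eqi: "complex_of_real (LINT x|M. indicator (Pi\<^sub>E J A) (\<lambda>j\<in>J. X j x)) =
        complex_of_real (LINT y|N. indicator (Pi\<^sub>E J A) (\<lambda>j\<in>J. Y j y))"
      using main[OF subset_refl, of A "\<lambda>_. 0"] A unfolding pr by simp
    have iX: "(LINT x|M. indicator (Pi\<^sub>E J A) (\<lambda>j\<in>J. X j x)) =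
        measure (distr M (PiM J (\<lambda>_. borel)) (\<lambda>x. \<lambda>j\<in>J. X j x)) (Pi\<^sub>E J A)"
      using PA by (subst integral_distr[OF mX, symmetric]) auto
    have iY: "(LINT x|N. indicator (Pi\<^sub>E J A) (\<lambda>j\<in>J. Y j x)) =
        measure (distr N (PiM J (\<lambda>_. borel)) (\<lambda>x. \<lambda>j\<in>J. Y j x)) (Pi\<^sub>E J A)"
      using PA by (subst integral_distr[OF mY, symmetric]) auto
    interpret dM: prob_space "distr M (PiM J (\<lambda>_. borel)) (\<lambda>x. \<lambda>j\<in>J. X j x)"
      using mX by (rule M.prob_space_distr)
    interpret dN: prob_space "distr N (PiM J (\<lambda>_. borel)) (\<lambda>x. \<lambda>j\<in>J. Y j x)"
      using mY by (rule N.prob_space_distr)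
    show "emeasure (distr M (PiM J (\<lambda>_. borel)) (\<lambda>x. \<lambda>j\<in>J. X j x)) (Pi\<^sub>E J A) =
        emeasure (distr N (PiM J (\<lambda>_. borel)) (\<lambda>y. \<lambda>j\<in>J. Y j y)) (Pi\<^sub>E J A)"
      using eqi iX iY by (simp add: dM.emeasure_eq_measure dN.emeasure_eq_measure)
  next
    show "range (\<lambda>_::nat. \<Pi>\<^sub>E j\<in>J. UNIV) \<subseteq> prod_algebra J (\<lambda>_. borel)"
      using \<open>finite J\<close> by (auto intro!: prod_algebraI_finite)
    interpret dM: prob_space "distr M (PiM J (\<lambda>_. borel)) (\<lambda>x. \<lambda>j\<in>J. X j x)"
      using mX by (rule M.prob_space_distr)
    show "emeasure (distr M (PiM J (\<lambda>_. borel)) (\<lambda>x. \<lambda>j\<in>J. X j x)) (\<Pi>\<^sub>E j\<in>J. UNIV) \<noteq> \<infinity>"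
      by simp
  qed (auto simp: space_PiM)
qed

section \<open>Finite functionals of fractional Brownian motion\<close>

text \<open>
  One formula covers both the normal and the degenerate case: the latter is the case in which the
  second moment vanishes.
\<close>

lemma centered_gaussian:
  assumes M: "prob_space M" and X: "gaussian_rv M X" and mean: "integral\<^sup>L M X = 0"
  shows "X \<in> borel_measurable M" "integrable M X" "integrable M (\<lambda>w. (X w)\<^sup>2)"
    and "(CLINT w|M. iexp (s * X w)) = exp (- s\<^sup>2 * integral\<^sup>L M (\<lambda>w. (X w)\<^sup>2) / 2)"
proof -
  interpret prob_space M by fact
  show mX[measurable]: "X \<in> borel_measurable M"
    using X by (simp add: gaussian_rv_def)
  from X consider \<mu> where "AE w in M. X w = \<mu>"
    | \<mu> \<sigma> where "0 < \<sigma>" "distributed M lborel X (\<lambda>x. ennreal (normal_density \<mu> \<sigma> x))"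
    unfolding gaussian_rv_def by blast
  then have "integrable M X \<and> integrable M (\<lambda>w. (X w)\<^sup>2) \<and>
    (CLINT w|M. iexp (s * X w)) = exp (- s\<^sup>2 * integral\<^sup>L M (\<lambda>w. (X w)\<^sup>2) / 2)"
  proof cases
    case (1 \<mu>)
    have "integral\<^sup>L M X = integral\<^sup>L M (\<lambda>_. \<mu>)"
      using 1 by (intro integral_cong_AE) auto
    with mean have "\<mu> = 0" by (simp add: prob_space)
    with 1 have X0: "AE w in M. X w = 0" by simp
    have "integrable M X \<longleftrightarrow> integrable M (\<lambda>_. 0 :: real)"
      using X0 by (intro integrable_cong_AE) auto
    moreover have "integrable M (\<lambda>w. (X w)\<^sup>2) \<longleftrightarrow> integrable M (\<lambda>_. 0 :: real)"
      using X0 by (intro integrable_cong_AE) auto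
    moreover have "integral\<^sup>L M (\<lambda>w. (X w)\<^sup>2) = 0"
      using X0 by (intro integral_eq_zero_AE) auto
    moreover have "(CLINT w|M. iexp (s * X w)) = (CLINT w|M. 1)"
      using X0 by (intro integral_cong_AE) auto
    ultimately show ?thesis by (simp add: prob_space)
  next
    case (2 \<mu> \<sigma>)
    have "\<mu> = 0"
      using normal_distributed_expectation[OF 2] mean by simp
    have int: "integrable M X"
      using distributed_integrable[OF 2(2), of "\<lambda>x. x"] integrable_normal_moment_nz_1[OF 2(1)] by simp
    have int2: "integrable M (\<lambda>w. (X w)\<^sup>2)"
      using distributed_integrable[OF 2(2), of "\<lambda>x. x\<^sup>2"] integrable_normal_moment[OF 2(1), of \<mu> 2] \<open>\<mu> = 0\<close>
      by simp
    have var: "integral\<^sup>L M (\<lambda>w. (X w)\<^sup>2) = \<sigma>\<^sup>2"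
      using normal_distributed_variance[OF 2] mean by simp
    have "distributed M lborel (\<lambda>w. X w / \<sigma>) std_normal_density"
      using 2(2) \<open>\<mu> = 0\<close> normal_standard_normal_convert[OF 2(1), of X \<mu>] by simp
    then have "distr M lborel (\<lambda>w. X w / \<sigma>) = std_normal_distribution"
      by (rule distributed_distr_eq_density)
    then have D: "distr M borel (\<lambda>w. X w / \<sigma>) = std_normal_distribution"
      by (simp cong: distr_cong)
    have "(CLINT w|M. iexp (s * X w)) = (CLINT w|M. iexp ((s * \<sigma>) * (X w / \<sigma>)))"
      using 2(1) by simp
    also have "\<dots> = char (distr M borel (\<lambda>w. X w / \<sigma>)) (s * \<sigma>)"
      unfolding char_def by (subst integral_distr) auto
    also have "\<dots> = exp (- s\<^sup>2 * \<sigma>\<^sup>2 / 2)"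
      unfolding D char_std_normal_distribution by (simp add: power_mult_distrib)
    finally show ?thesis using int int2 var by simp
  qed
  then show "integrable M X" "integrable M (\<lambda>w. (X w)\<^sup>2)"
    "(CLINT w|M. iexp (s * X w)) = exp (- s\<^sup>2 * integral\<^sup>L M (\<lambda>w. (X w)\<^sup>2) / 2)"
    by blast+
qed

text \<open>
  A path functional that is a finite linear combination of evaluations.  The evaluation points are
  kept in a finite set, so that each occurs once, as in the definition of a Gaussian process.
\<close>

definition finite_functional :: "((real \<Rightarrow> real) \<Rightarrow> real) \<Rightarrow> bool" where
  "finite_functional F \<longleftrightarrow> (\<exists>K c. finite K \<and> F = (\<lambda>x. \<Sum>t\<in>K. c t * x t))"

lemma finite_functional_eval: "finite_functional (\<lambda>x. x t)"
  unfolding finite_functional_def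
  by (rule exI[of _ "{t}"], rule exI[of _ "\<lambda>_. 1"]) simp

lemma finite_functional_zero: "finite_functional (\<lambda>x. 0)"
  unfolding finite_functional_def
  by (rule exI[of _ "{}"]) simp

lemma finite_functional_cmult:
  assumes "finite_functional F"
  shows "finite_functional (\<lambda>x. a * F x)"
proof -
  from assms obtain K c where "finite K" "F = (\<lambda>x. \<Sum>t\<in>K. c t * x t)"
    unfolding finite_functional_def by blast
  then show ?thesis
    unfolding finite_functional_def
    by (intro exI[of _ K] exI[of _ "\<lambda>t. a * c t"]) (simp add: sum_distrib_left mult.assoc)
qed

lemma finite_functional_add:
  assumes "finite_functional F" "finite_functional G"
  shows "finite_functional (\<lambda>x. F x + G x)"
proof -
  from assms obtain K c L d where *: "finite K" "F = (\<lambda>x. \<Sum>t\<in>K. c t * x t)"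
      "finite L" "G = (\<lambda>x. \<Sum>t\<in>L. d t * x t)"
    unfolding finite_functional_def by blast
  have "F x + G x = (\<Sum>t\<in>K \<union> L. ((if t \<in> K then c t else 0) + (if t \<in> L then d t else 0)) * x t)" for x
  proof -
    have "F x = (\<Sum>t\<in>K \<union> L. (if t \<in> K then c t else 0) * x t)"
      unfolding * using *(1,3) by (intro sum.mono_neutral_cong_left) auto
    moreover have "G x = (\<Sum>t\<in>K \<union> L. (if t \<in> L then d t else 0) * x t)"
      unfolding * using *(1,3) by (intro sum.mono_neutral_cong_left) auto
    ultimately show ?thesis
      by (simp add: sum.distrib distrib_right)
  qed
  then have "(\<lambda>x. F x + G x) = (\<lambda>x. \<Sum>t\<in>K \<union> L. ((if t \<in> K then c t else 0) + (if t \<in> L then d t else 0)) * x t)"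
    by (rule ext)
  then show ?thesis
    unfolding finite_functional_def using *(1,3)
    by (intro exI[of _ "K \<union> L"] exI[of _ "\<lambda>t. (if t \<in> K then c t else 0) + (if t \<in> L then d t else 0)"]) auto
qed

lemma finite_functional_diff:
  assumes "finite_functional F" "finite_functional G"
  shows "finite_functional (\<lambda>x. F x - G x)"
  using finite_functional_add[OF assms(1) finite_functional_cmult[OF assms(2), of "-1"]] by simp

lemma finite_functional_sum:
  "(\<And>i. i \<in> I \<Longrightarrow> finite_functional (F i)) \<Longrightarrow> finite_functional (\<lambda>x. \<Sum>i\<in>I. F i x)"
  by (induction I rule: infinite_finite_induct)
     (auto intro: finite_functional_add finite_functional_zero)

lemmas finite_functional_intros =
  finite_functional_eval finite_functional_zero finite_functional_cmult finite_functional_add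
  finite_functional_diff finite_functional_sum

context
  fixes H :: real and M :: "'w measure" and B :: "real \<Rightarrow> 'w \<Rightarrow> real"
  assumes fbm: "two_sided_fbm H M B"
begin

lemma fbm_prob_space: "prob_space M"
  using fbm by (simp add: two_sided_fbm_def)

lemma gaussian_rv_finite_functional:
  assumes "finite_functional F"
  shows "gaussian_rv M (\<lambda>w. F (\<lambda>t. B t w))"
  using assms fbm unfolding finite_functional_def two_sided_fbm_def gaussian_process_def by auto

lemma integrable_fbm: "integrable M (B t)"
proof -
  have "gaussian_rv M (B t)" "integral\<^sup>L M (B t) = 0"
    using gaussian_rv_finite_functional[OF finite_functional_eval, of t] fbm
    by (auto simp: two_sided_fbm_def)
  then show ?thesis
    by (rule centered_gaussian(2)[OF fbm_prob_space])
qed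

lemma finite_functional_mean:
  assumes "finite_functional F"
  shows "(LINT w|M. F (\<lambda>t. B t w)) = 0"
  using assms fbm unfolding finite_functional_def
  by (auto simp: integrable_fbm two_sided_fbm_def)

lemma integrable_finite_functional_mult:
  assumes "finite_functional F" "finite_functional G"
  shows "integrable M (\<lambda>w. F (\<lambda>t. B t w) * G (\<lambda>t. B t w))"
proof (rule Bochner_Integration.integrable_bound)
  note F = centered_gaussian[OF fbm_prob_space gaussian_rv_finite_functional[OF assms(1)]
      finite_functional_mean[OF assms(1)]]
  note G = centered_gaussian[OF fbm_prob_space gaussian_rv_finite_functional[OF assms(2)]
      finite_functional_mean[OF assms(2)]]
  show "integrable M (\<lambda>w. (F (\<lambda>t. B t w))\<^sup>2 + (G (\<lambda>t. B t w))\<^sup>2)"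
    by (intro Bochner_Integration.integrable_add F(3) G(3))
  show "(\<lambda>w. F (\<lambda>t. B t w) * G (\<lambda>t. B t w)) \<in> borel_measurable M"
    by (intro borel_measurable_times F(1) G(1))
  have "\<bar>a * b\<bar> \<le> \<bar>a\<^sup>2 + b\<^sup>2\<bar>" for a b :: real
  proof -
    have "2 * (\<bar>a\<bar> * \<bar>b\<bar>) \<le> a\<^sup>2 + b\<^sup>2" "0 \<le> \<bar>a\<bar> * \<bar>b\<bar>"
      using sum_squares_bound[of "\<bar>a\<bar>" "\<bar>b\<bar>"] by (simp_all add: mult.assoc)
    then show ?thesis unfolding abs_mult by linarith
  qed
  then show "AE w in M. norm (F (\<lambda>t. B t w) * G (\<lambda>t. B t w)) \<le>
      norm ((F (\<lambda>t. B t w))\<^sup>2 + (G (\<lambda>t. B t w))\<^sup>2)"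
    by simp
qed

lemma integrable_fbm_mult: "integrable M (\<lambda>w. B s w * B t w)"
  using integrable_finite_functional_mult[OF finite_functional_eval finite_functional_eval] .

lemma expectation_fbm_mult: "(LINT w|M. B s w * B t w) = fbm_cov H s t"
proof -
  have "integral\<^sup>L M (B t) = 0" "covariance M (B s) (B t) = fbm_cov H s t" for s t
    using fbm by (auto simp: two_sided_fbm_def)
  then show ?thesis
    unfolding covariance_def by simp
qed

lemma char_finite_functional:
  assumes "finite_functional F"
  shows "(CLINT w|M. iexp (s * F (\<lambda>t. B t w))) = exp (- s\<^sup>2 * (LINT w|M. (F (\<lambda>t. B t w))\<^sup>2) / 2)"
  by (rule centered_gaussian[OF fbm_prob_space gaussian_rv_finite_functional[OF assms]
        finite_functional_mean[OF assms]])

text \<open>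
  The second moment, hence the whole law, of a finite functional of a fractional Brownian motion
  depends on the covariance function only.
\<close>

lemma finite_functional_second_moment:
  assumes "finite K"
  shows "(LINT w|M. (\<Sum>t\<in>K. c t * B t w)\<^sup>2) = (\<Sum>t\<in>K. \<Sum>u\<in>K. c t * c u * fbm_cov H t u)"
proof -
  have "(LINT w|M. (\<Sum>t\<in>K. c t * B t w)\<^sup>2) = (LINT w|M. (\<Sum>t\<in>K. \<Sum>u\<in>K. (c t * c u) * (B t w * B u w)))"
    by (simp add: power2_eq_square sum_product ac_simps)
  also have "\<dots> = (\<Sum>t\<in>K. \<Sum>u\<in>K. c t * c u * fbm_cov H t u)"
    using integrable_fbm_mult by (simp add: expectation_fbm_mult del: sum_distrib_left)
  finally show ?thesis .
qed

text \<open>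
  Fractional Brownian motion has stationary increments, in the form that is needed here: the motion
  restarted at time \<open>h\<close> is again a fractional Brownian motion.
\<close>

lemma two_sided_fbm_shift:
  "two_sided_fbm H M (\<lambda>t w. B (t + h) w - B h w)"
proof -
  have mean: "(LINT w|M. B (t + h) w - B h w) = 0" for t
    by (rule finite_functional_mean[of "\<lambda>x. x (t + h) - x h"]) (intro finite_functional_intros)
  have "gaussian_process M UNIV (\<lambda>t w. B (t + h) w - B h w)"
    unfolding gaussian_process_def
  proof (intro allI impI)
    fix J :: "real set" and a :: "real \<Rightarrow> real"
    have "finite_functional (\<lambda>x. \<Sum>i\<in>J. a i * (x (i + h) - x h))"
      by (intro finite_functional_intros)
    then show "gaussian_rv M (\<lambda>w. \<Sum>i\<in>J. a i * (B (i + h) w - B h w))"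
      by (rule gaussian_rv_finite_functional)
  qed
  moreover have "covariance M (\<lambda>w. B (s + h) w - B h w) (\<lambda>w. B (t + h) w - B h w) = fbm_cov H s t" for s t
  proof -
    have "covariance M (\<lambda>w. B (s + h) w - B h w) (\<lambda>w. B (t + h) w - B h w) =
      (LINT w|M. B (s + h) w * B (t + h) w - B (s + h) w * B h w - B h w * B (t + h) w + B h w * B h w)"
      unfolding covariance_def mean by (simp add: algebra_simps)
    also have "\<dots> = fbm_cov H (s + h) (t + h) - fbm_cov H (s + h) h - fbm_cov H h (t + h) + fbm_cov H h h"
      by (simp add: integrable_fbm_mult expectation_fbm_mult)
    also have "\<dots> = fbm_cov H s t"
      by (simp add: fbm_cov_def field_simps)
    finally show ?thesis .
  qed
  ultimately show ?thesis
    using fbm_prob_space mean unfolding two_sided_fbm_def by auto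
qed

end

lemma char_finite_functional_cong:
  assumes "two_sided_fbm H M B" "two_sided_fbm H N B'" "finite_functional F"
  shows "(CLINT w|M. iexp (F (\<lambda>t. B t w))) = (CLINT w|N. iexp (F (\<lambda>t. B' t w)))"
proof -
  have "(LINT w|M. (F (\<lambda>t. B t w))\<^sup>2) = (LINT w|N. (F (\<lambda>t. B' t w))\<^sup>2)"
    using assms(3) finite_functional_second_moment[OF assms(1)] finite_functional_second_moment[OF assms(2)]
    unfolding finite_functional_def by auto
  then show ?thesis
    using char_finite_functional[OF assms(1,3), of 1] char_finite_functional[OF assms(2,3), of 1] by simp
qed

section \<open>Riemann sums\<close>

text \<open>
  The bound depends on \<open>f\<close> through its oscillation only.  This uniformity gives the convergence of
  the iterated sums in two variables below.
\<close>

lemma riemann_sum_error_le: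
  fixes f :: "real \<Rightarrow> real"
  assumes f: "f integrable_on {0..1}" and n: "0 < (n::nat)"
    and osc: "\<And>x y. x \<in> {0..1} \<Longrightarrow> y \<in> {0..1} \<Longrightarrow> \<bar>x - y\<bar> \<le> 1 / n \<Longrightarrow> \<bar>f x - f y\<bar> \<le> e"
  shows "\<bar>(\<Sum>i<n. f (real i / real n)) / n - integral {0..1} f\<bar> \<le> e"
proof -
  have "\<bar>(\<Sum>i<k. f (real i / real n)) / n - integral {0..k / n} f\<bar> \<le> real k * (e / n)" 
    if "k \<le> n" for k :: nat
    using that
  proof (induction k)
    case 0
    then show ?case using osc[of 0 0] by simp
  next
    case (Suc k)
    let ?a = "real k / n" and ?b = "real (Suc k) / n"
    have le: "0 \<le> ?a" "?a \<le> ?b" "?b \<le> 1"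
      using Suc.prems n by (auto simp: divide_right_mono)
    have len: "?b - ?a = 1 / n"
      by (simp add: diff_divide_distrib[symmetric])
    have int_b: "f integrable_on {0..?b}"
      using le by (intro integrable_subinterval_real[OF f]) auto
    have int_ab: "f integrable_on {?a..?b}"
      using le by (intro integrable_subinterval_real[OF f]) auto
    have split: "integral {0..?b} f = integral {0..?a} f + integral {?a..?b} f"
      using Henstock_Kurzweil_Integration.integral_combine[OF le(1,2) int_b] by simp
    have "\<bar>integral {?a..?b} (\<lambda>x. f x - f ?a)\<bar> \<le> e * (?b - ?a)"
    proof -
      have "0 \<le> e" using osc[of 0 0] by simp
      have "norm (integral {?a..?b} (\<lambda>x. f x - f ?a)) \<le> e * Sigma_Algebra.measure lborel {?a..?b}"
        unfolding box_real(2)[symmetric]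
      proof (rule has_integral_bound[OF \<open>0 \<le> e\<close>])
        show "((\<lambda>x. f x - f ?a) has_integral integral (cbox ?a ?b) (\<lambda>x. f x - f ?a)) (cbox ?a ?b)"
          using int_ab by (intro integrable_integral integrable_diff) (auto simp: box_real)
        fix x assume "x \<in> cbox ?a ?b"
        then have "?a \<le> x" "x \<le> ?b" by simp_all
        then have "0 \<le> x" "x \<le> 1" "\<bar>x - ?a\<bar> \<le> 1 / n"
          using le len by linarith+
        then show "norm (f x - f ?a) \<le> e"
          unfolding real_norm_def using le by (intro osc) auto
      qed
      then show ?thesis using le by simp
    qed
    moreover have "integral {?a..?b} (\<lambda>x. f x - f ?a) = integral {?a..?b} f - f ?a * (?b - ?a)"
      using int_ab le by (subst Henstock_Kurzweil_Integration.integral_diff) auto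
    ultimately have "\<bar>f ?a / n - integral {?a..?b} f\<bar> \<le> e / n"
      unfolding len by (simp add: abs_minus_commute)
    moreover have "\<bar>(\<Sum>i<k. f (real i / real n)) / n - integral {0..?a} f\<bar> \<le> real k * (e / n)"
      using Suc by simp
    moreover have "(\<Sum>i<Suc k. f (real i / real n)) / n = (\<Sum>i<k. f (real i / real n)) / n + f ?a / n"
      by (simp add: add_divide_distrib)
    moreover have "real (Suc k) * (e / n) = k * (e / n) + e / n"
      by (simp add: distrib_right add_divide_distrib)
    ultimately show ?case
      unfolding split by linarith
  qed
  from this[of n] show ?thesis using n by simp
qed

lemma riemann_sum_tendsto:
  fixes f :: "real \<Rightarrow> real"
  assumes f: "continuous_on {0..1} f"
  shows "(\<lambda>n. (\<Sum>i<n. f (real i / real n)) / n) \<longlonglongrightarrow> integral {0..1} f"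
proof (rule tendstoI)
  fix e :: real assume "0 < e"
  have "uniformly_continuous_on {0..1} f"
    using f by (intro compact_uniformly_continuous) auto
  then obtain d where "0 < d"
    and d: "\<And>x y. x \<in> {0..1} \<Longrightarrow> y \<in> {0..1} \<Longrightarrow> dist x y < d \<Longrightarrow> dist (f x) (f y) < e / 2"
    using \<open>0 < e\<close> unfolding uniformly_continuous_on_def by (metis half_gt_zero)
  have "\<forall>\<^sub>F n in sequentially. 1 / real n < d"
    using \<open>0 < d\<close> by real_asymp
  then show "\<forall>\<^sub>F n in sequentially. dist ((\<Sum>i<n. f (real i / real n)) / n) (integral {0..1} f) < e"
    using eventually_gt_at_top[of 0]
  proof eventually_elim
    case (elim n)
    have "\<bar>(\<Sum>i<n. f (real i / real n)) / n - integral {0..1} f\<bar> \<le> e / 2"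
      using elim d[unfolded dist_real_def, THEN less_imp_le] f
      by (intro riemann_sum_error_le integrable_continuous_real)
         (fastforce simp: dist_real_def)+
    then show ?case using \<open>0 < e\<close> by (simp add: dist_real_def)
  qed
qed

lemma double_riemann_sum_tendsto:
  fixes g :: "real \<Rightarrow> real \<Rightarrow> real"
  assumes g: "continuous_on ({0..1} \<times> {0..1}) (\<lambda>(u, s). g u s)"
  shows "(\<lambda>n. (\<Sum>i<n. \<Sum>j<n. g (real i / real n) (real j / real n)) / (real n)\<^sup>2)
    \<longlonglongrightarrow> integral {0..1} (\<lambda>u. integral {0..1} (g u))"
proof (rule tendstoI)
  fix e :: real assume "0 < e"
  have slice: "continuous_on {0..1} (g u)" if "u \<in> {0..1}" for u
  proof -
    have "continuous_on {0..1} (\<lambda>s. case (u, s) of (u, s) \<Rightarrow> g u s)"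
      using that by (intro continuous_on_compose2[OF g] continuous_intros) auto
    then show ?thesis by simp
  qed
  have G: "continuous_on {0..1} (\<lambda>u. integral {0..1} (g u))"
    using integral_continuous_on_param[of "{0..1}" 0 1 g] g by simp
  have "uniformly_continuous_on ({0..1} \<times> {0..1}) (\<lambda>(u, s). g u s)"
    using g by (intro compact_uniformly_continuous compact_Times) auto
  then obtain d where "0 < d"
    and d: "\<And>x y. x \<in> {0..1} \<times> {0..1} \<Longrightarrow> y \<in> {0..1} \<times> {0..1} \<Longrightarrow> dist x y < d \<Longrightarrow>
        dist (case x of (u, s) \<Rightarrow> g u s) (case y of (u, s) \<Rightarrow> g u s) < e / 3"
    using \<open>0 < e\<close> unfolding uniformly_continuous_on_def by (metis zero_less_divide_iff zero_less_numeral)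
  have d1: "\<bar>g u s - g u' s\<bar> \<le> e / 3"
    if "u \<in> {0..1}" "u' \<in> {0..1}" "s \<in> {0..1}" "\<bar>u - u'\<bar> < d" for u u' s
    using d[of "(u, s)" "(u', s)"] that by (simp add: dist_prod_def dist_real_def)
  have d2: "\<bar>g u s - g u s'\<bar> \<le> e / 3"
    if "u \<in> {0..1}" "s' \<in> {0..1}" "s \<in> {0..1}" "\<bar>s - s'\<bar> < d" for u s s'
    using d[of "(u, s)" "(u, s')"] that by (simp add: dist_prod_def dist_real_def)
  have dG: "\<bar>integral {0..1} (g u) - integral {0..1} (g u')\<bar> \<le> e / 3"
    if "u \<in> {0..1}" "u' \<in> {0..1}" "\<bar>u - u'\<bar> < d" for u u'
  proof -
    have "norm (integral {0..1} (\<lambda>s. g u s - g u' s)) \<le> integral {0..1} (\<lambda>s::real. e / 3)"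
    proof (rule Henstock_Kurzweil_Integration.integral_norm_bound_integral)
      show "(\<lambda>s. g u s - g u' s) integrable_on {0..1}"
        using slice that by (intro integrable_continuous_real continuous_on_diff) auto
    qed (use that d1 in auto)
    then show ?thesis
      using that slice
      by (subst (asm) Henstock_Kurzweil_Integration.integral_diff) (auto intro!: integrable_continuous_real)
  qed
  have "\<forall>\<^sub>F n in sequentially. 1 / real n < d"
    using \<open>0 < d\<close> by real_asymp
  then show "\<forall>\<^sub>F n in sequentially. dist ((\<Sum>i<n. \<Sum>j<n. g (real i / real n) (real j / real n)) / (real n)\<^sup>2)
      (integral {0..1} (\<lambda>u. integral {0..1} (g u))) < e"
    using eventually_gt_at_top[of 0]
  proof eventually_elim
    case (elim n)
    let ?G = "\<lambda>u. integral {0..1} (g u)"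
    \<comment> \<open>A third of \<open>e\<close> is spent on the inner sums, uniformly in \<open>u\<close>, and a third on the outer sum.\<close>
    have inner: "\<bar>(\<Sum>j<n. g u (real j / real n)) / n - ?G u\<bar> \<le> e / 3" if "u \<in> {0..1}" for u
      using elim d2 slice that
      by (intro riemann_sum_error_le integrable_continuous_real) (auto intro: less_imp_le)
    have outer: "\<bar>(\<Sum>i<n. ?G (real i / real n)) / n - integral {0..1} ?G\<bar> \<le> e / 3"
      using elim dG G by (intro riemann_sum_error_le integrable_continuous_real) auto
    have "\<bar>(\<Sum>i<n. (\<Sum>j<n. g (real i / real n) (real j / real n)) / n - ?G (real i / real n))\<bar> \<le> (\<Sum>i<n. e / 3)"
      by (rule order_trans[OF sum_abs sum_mono], rule inner) (use elim in auto)
    then have "\<bar>(\<Sum>i<n. (\<Sum>j<n. g (real i / real n) (real j / real n)) / n - ?G (real i / real n)) / n\<bar> \<le> e / 3"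
      using elim by (simp add: field_simps)
    moreover have "(\<Sum>i<n. (\<Sum>j<n. g (real i / real n) (real j / real n)) / n - ?G (real i / real n)) / n =
        (\<Sum>i<n. \<Sum>j<n. g (real i / real n) (real j / real n)) / (real n)\<^sup>2 - (\<Sum>i<n. ?G (real i / real n)) / n"
      by (simp add: sum_subtractf diff_divide_distrib sum_divide_distrib power2_eq_square)
    ultimately show ?case
      using outer \<open>0 < e\<close> unfolding dist_real_def by linarith
  qed
qed

section \<open>Absolute moments of the normal law\<close>

lemma std_normal_abs_moment:
  fixes p :: real
  assumes "-1 < p"
  shows "has_bochner_integral std_normal_distribution (\<lambda>x. \<bar>x\<bar> powr p)
    (2 powr (p / 2) * Gamma ((p + 1) / 2) / sqrt pi)"
proof -
  define a where "a = (p + 1) / 2"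
  have "0 < a" using assms by (simp add: a_def)
  define f where "f t = t powr (a - 1) / exp t" for t :: real
  define h where "h x = \<bar>x\<bar> powr p * exp (- x\<^sup>2 / 2)" for x :: real
  have "(f has_integral Gamma a) {0..}"
    using Gamma_integral_real[OF \<open>0 < a\<close>] by (simp add: f_def[abs_def])
  moreover have "(f has_integral Gamma a) {0<..} \<longleftrightarrow> (f has_integral Gamma a) {0..}"
    by (rule has_integral_spike_set_eq) (auto intro: negligible_subset[of "{0}"])
  ultimately have "(f has_integral Gamma a) {0<..}" by simp
  then have f: "f absolutely_integrable_on {0<..}" "integral {0<..} f = Gamma a"
    by (auto intro!: nonnegative_absolutely_integrable_1 simp: integrable_on_def f_def integral_unique)
  have img: "(\<lambda>x. x\<^sup>2 / 2) ` {0<..} = {0 :: real<..}"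
  proof safe
    fix y :: real assume "0 < y"
    then show "y \<in> (\<lambda>x. x\<^sup>2 / 2) ` {0<..}"
      by (intro image_eqI[of _ _ "sqrt (2 * y)"]) auto
  qed auto
  \<comment> \<open>Substitution of \<open>x\<^sup>2 / 2\<close> in the Gamma integral; the moment over the line follows by symmetry.\<close>
  have sub: "(\<lambda>x. \<bar>x\<bar> * f (x\<^sup>2 / 2)) absolutely_integrable_on {0<..} \<and>
      integral {0<..} (\<lambda>x. \<bar>x\<bar> * f (x\<^sup>2 / 2)) = Gamma a"
  proof (rule has_absolute_integral_change_of_variables_1'
        [where f = f and g = "\<lambda>x. x\<^sup>2 / 2" and g' = "\<lambda>x. x", THEN iffD2])
    show "inj_on (\<lambda>x. x\<^sup>2 / 2) {0 :: real<..}"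
      by (auto intro!: inj_onI)
    show "((\<lambda>x. x\<^sup>2 / 2) has_field_derivative x) (at x within {0<..})" for x :: real
      by (auto intro!: derivative_eq_intros)
    show "f absolutely_integrable_on (\<lambda>x. x\<^sup>2 / 2) ` {0<..} \<and>
        integral ((\<lambda>x. x\<^sup>2 / 2) ` {0<..}) f = Gamma a"
      using f by (simp add: img)
  qed auto
  have fh: "\<bar>x\<bar> * f (x\<^sup>2 / 2) = 2 powr (1 - a) * h x" if "0 < x" for x
  proof -
    have "(x\<^sup>2 / 2) powr (a - 1) = 2 powr (1 - a) * x powr (p - 1)"
    proof -
      have "(x\<^sup>2 / 2) powr (a - 1) = (x powr 2) powr (a - 1) / 2 powr (a - 1)"
        using that by (simp add: powr_divide powr_realpow)
      also have "\<dots> = x powr (p - 1) * 2 powr (- (a - 1))"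
      proof -
        have "2 * (a - 1) = p - 1" by (simp add: a_def)
        then show ?thesis unfolding powr_powr powr_minus by (simp add: divide_inverse)
      qed
      finally show ?thesis by simp
    qed
    moreover have "x * x powr (p - 1) = x powr p"
      using that by (simp add: powr_mult_base)
    ultimately show ?thesis
      using that by (simp add: f_def h_def exp_minus field_simps)
  qed
  have [measurable]: "h \<in> borel_measurable borel" "f \<in> borel_measurable borel"
    unfolding h_def[abs_def] f_def[abs_def] by measurable
  have *: "integrable lborel (\<lambda>x. indicator {0<..} x *\<^sub>R (\<bar>x\<bar> * f (x\<^sup>2 / 2)))"
    using sub by (simp add: set_integrable_def integrable_completion)
  moreover have "(LINT x|lborel. indicator {0<..} x *\<^sub>R (\<bar>x\<bar> * f (x\<^sup>2 / 2))) = Gamma a"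
    using set_borel_integral_eq_integral(2)[of "{0<..}" "\<lambda>x. \<bar>x\<bar> * f (x\<^sup>2 / 2)"] * sub
    by (simp add: set_integrable_def set_lebesgue_integral_def)
  ultimately have "has_bochner_integral lborel (\<lambda>x. indicator {0<..} x *\<^sub>R (\<bar>x\<bar> * f (x\<^sup>2 / 2))) (Gamma a)"
    by (simp add: has_bochner_integral_iff)
  from has_bochner_integral_mult_right[OF this, of "2 powr (a - 1)"]
  have "has_bochner_integral lborel (\<lambda>x. indicator {0..} x *\<^sub>R h x) (2 powr (a - 1) * Gamma a)"
  proof (rule has_bochner_integral_cong[THEN iffD1, rotated -1])
    fix x :: real
    show "2 powr (a - 1) * (indicator {0<..} x *\<^sub>R (\<bar>x\<bar> * f (x\<^sup>2 / 2))) = indicator {0..} x *\<^sub>R h x"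
    proof (cases "0 < x")
      case True
      have "2 powr (a - 1) * (2 powr (1 - a) * h x) = h x"
        by (simp add: mult.assoc[symmetric] powr_add[symmetric])
      then show ?thesis using True fh[OF True] by simp
    qed (auto simp: h_def indicator_def)
  qed auto
  then have "has_bochner_integral lborel h (2 *\<^sub>R (2 powr (a - 1) * Gamma a))"
    by (rule has_bochner_integral_even_function) (simp add: h_def)
  from has_bochner_integral_mult_right[OF this, of "1 / sqrt (2 * pi)"]
  have "has_bochner_integral lborel (\<lambda>x. std_normal_density x *\<^sub>R \<bar>x\<bar> powr p)
      (1 / sqrt (2 * pi) * (2 *\<^sub>R (2 powr (a - 1) * Gamma a)))"
    by (simp add: std_normal_density_def h_def mult.commute mult.left_commute)
  also have "1 / sqrt (2 * pi) * (2 *\<^sub>R (2 powr (a - 1) * Gamma a)) =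
      2 powr (p / 2) * Gamma ((p + 1) / 2) / sqrt pi"
  proof -
    have "1 + (a - 1) = 1 / 2 + p / 2" by (simp add: a_def add_divide_distrib)
    then have "2 powr 1 * 2 powr (a - 1) = 2 powr (1 / 2) * 2 powr (p / 2)"
      by (simp only: powr_add[symmetric])
    then have "2 * 2 powr (a - 1) = sqrt 2 * 2 powr (p / 2)"
      by (simp add: powr_half_sqrt)
    then show ?thesis
      unfolding a_def[symmetric] by (simp add: real_sqrt_mult field_simps)
  qed
  finally show ?thesis
    by (intro has_bochner_integral_density) auto
qed

text \<open>
  The case \<open>v = 0\<close>, in which \<open>Z\<close> vanishes almost surely, needs no separate treatment: \<open>Z\<close> has the
  law of \<open>sqrt v\<close> times a standard normal variable, and \<open>0 powr p = 0\<close> for every \<open>p\<close>.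
\<close>

lemma abs_moment_centered_normal_char:
  fixes Z :: "'a \<Rightarrow> real" and p :: real
  assumes M: "prob_space M" and Z[measurable]: "Z \<in> borel_measurable M" and "0 \<le> v" and "-1 < p"
    and char: "\<And>s. (CLINT w|M. iexp (s * Z w)) = exp (- s\<^sup>2 * v / 2)"
  shows "integrable M (\<lambda>w. \<bar>Z w\<bar> powr p)"
    and "(LINT w|M. \<bar>Z w\<bar> powr p) = 2 powr (p / 2) * Gamma ((p + 1) / 2) / sqrt pi * v powr (p / 2)"
proof -
  interpret prob_space M by fact
  interpret N: prob_space std_normal_distribution
    by (rule prob_space_normal_density) simp
  have "char (distr M borel Z) = char (distr std_normal_distribution borel (\<lambda>x. sqrt v * x))"
  proof
    fix s
    have "char (distr std_normal_distribution borel (\<lambda>x. sqrt v * x)) s =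
        (CLINT x|std_normal_distribution. iexp ((s * sqrt v) * x))"
      unfolding char_def by (subst integral_distr) (auto simp: mult.assoc)
    also have "\<dots> = char std_normal_distribution (s * sqrt v)"
      by (simp only: char_def)
    also have "\<dots> = exp (- s\<^sup>2 * v / 2)"
      unfolding char_std_normal_distribution using \<open>0 \<le> v\<close> by (simp add: power_mult_distrib)
    also have "\<dots> = char (distr M borel Z) s"
      unfolding char_def char[symmetric] by (subst integral_distr) auto
    finally show "char (distr M borel Z) s = char (distr std_normal_distribution borel (\<lambda>x. sqrt v * x)) s"
      by simp
  qed
  then have law: "distr M borel Z = distr std_normal_distribution borel (\<lambda>x. sqrt v * x)"
    by (intro Levy_uniqueness real_distribution_distr N.real_distribution_distr) auto
  have "sqrt v powr p = v powr (p / 2)"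
    using \<open>0 \<le> v\<close> by (simp add: powr_half_sqrt[symmetric] powr_powr)
  then have "\<bar>sqrt v * x\<bar> powr p = v powr (p / 2) * \<bar>x\<bar> powr p" for x
    using \<open>0 \<le> v\<close> by (simp add: abs_mult powr_mult)
  with has_bochner_integral_mult_right[OF std_normal_abs_moment[OF \<open>-1 < p\<close>], of "v powr (p / 2)"]
  have "has_bochner_integral std_normal_distribution (\<lambda>x. \<bar>sqrt v * x\<bar> powr p)
      (v powr (p / 2) * (2 powr (p / 2) * Gamma ((p + 1) / 2) / sqrt pi))"
    by simp
  then have "has_bochner_integral (distr std_normal_distribution borel (\<lambda>x. sqrt v * x)) (\<lambda>z. \<bar>z\<bar> powr p)
      (v powr (p / 2) * (2 powr (p / 2) * Gamma ((p + 1) / 2) / sqrt pi))"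
    by (intro has_bochner_integral_distr) auto
  then have "has_bochner_integral M (\<lambda>w. \<bar>Z w\<bar> powr p)
      (v powr (p / 2) * (2 powr (p / 2) * Gamma ((p + 1) / 2) / sqrt pi))"
    unfolding law[symmetric] has_bochner_integral_iff
    by (simp add: integrable_distr_eq integral_distr)
  then show "integrable M (\<lambda>w. \<bar>Z w\<bar> powr p)"
    "(LINT w|M. \<bar>Z w\<bar> powr p) = 2 powr (p / 2) * Gamma ((p + 1) / 2) / sqrt pi * v powr (p / 2)"
    by (auto simp: has_bochner_integral_iff ac_simps)
qed

section \<open>Pathwise limits of finite functionals\<close>

lemma char_limit:
  fixes Z :: "'a \<Rightarrow> real"
  assumes M: "prob_space M" and F: "\<And>n. F n \<in> borel_measurable M"
    and lim: "\<And>w. w \<in> space M \<Longrightarrow> (\<lambda>n. F n w) \<longlonglongrightarrow> Z w"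
  shows "(\<lambda>n. CLINT w|M. iexp (F n w)) \<longlonglongrightarrow> (CLINT w|M. iexp (Z w))"
proof -
  interpret prob_space M by fact
  note F[measurable]
  have [measurable]: "Z \<in> borel_measurable M"
    by (rule borel_measurable_LIMSEQ_real[OF lim F])
  show ?thesis
  proof (rule integral_dominated_convergence[where w = "\<lambda>_. 1"])
    show "AE w in M. (\<lambda>n. iexp (F n w)) \<longlonglongrightarrow> iexp (Z w)"
      using lim by (intro AE_I2 tendsto_intros) auto
  qed auto
qed

text \<open>
  A path functional that is a pointwise limit, on the continuous paths vanishing at zero, of finite
  functionals.
\<close>

definition limit_functional :: "((real \<Rightarrow> real) \<Rightarrow> real) \<Rightarrow> bool" where
  "limit_functional X \<longleftrightarrow>
     (\<exists>F. (\<forall>n::nat. finite_functional (F n)) \<and> (\<forall>\<omega>\<in>C0. (\<lambda>n. F n \<omega>) \<longlonglongrightarrow> X \<omega>))"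

lemma limit_functional_lincomb:
  assumes "\<And>i. i \<in> I \<Longrightarrow> limit_functional (X i)"
  shows "limit_functional (\<lambda>\<omega>. \<Sum>i\<in>I. a i * X i \<omega>)"
proof -
  from assms obtain F where "\<And>i n. i \<in> I \<Longrightarrow> finite_functional (F i n)"
    "\<And>i \<omega>. i \<in> I \<Longrightarrow> \<omega> \<in> C0 \<Longrightarrow> (\<lambda>n. F i n \<omega>) \<longlonglongrightarrow> X i \<omega>"
    unfolding limit_functional_def by metis
  then show ?thesis
    unfolding limit_functional_def
    by (intro exI[of _ "\<lambda>n \<omega>. \<Sum>i\<in>I. a i * F i n \<omega>"])
       (auto intro!: finite_functional_sum finite_functional_cmult tendsto_intros)
qed

lemma measurable_limit_functional:
  assumes fbm: "two_sided_fbm H M B" and paths: "\<And>w. w \<in> space M \<Longrightarrow> (\<lambda>t. B t w) \<in> C0"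
    and X: "limit_functional X"
  shows "(\<lambda>w. X (\<lambda>t. B t w)) \<in> borel_measurable M"
proof -
  from X obtain F where F: "\<And>n::nat. finite_functional (F n)"
    and lim: "\<And>\<omega>. \<omega> \<in> C0 \<Longrightarrow> (\<lambda>n. F n \<omega>) \<longlonglongrightarrow> X \<omega>"
    unfolding limit_functional_def by blast
  show ?thesis
  proof (rule borel_measurable_LIMSEQ_real[where u = "\<lambda>n w. F n (\<lambda>t. B t w)"])
    show "(\<lambda>w. F n (\<lambda>t. B t w)) \<in> borel_measurable M" for n
      using gaussian_rv_finite_functional[OF fbm F] by (simp add: gaussian_rv_def)
  qed (use lim paths in auto)
qed

lemma char_limit_functional_cong:
  assumes M: "two_sided_fbm H M B" "\<And>w. w \<in> space M \<Longrightarrow> (\<lambda>t. B t w) \<in> C0"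
    and N: "two_sided_fbm H N B'" "\<And>w. w \<in> space N \<Longrightarrow> (\<lambda>t. B' t w) \<in> C0"
    and X: "limit_functional X"
  shows "(CLINT w|M. iexp (X (\<lambda>t. B t w))) = (CLINT w|N. iexp (X (\<lambda>t. B' t w)))"
proof -
  from X obtain F where F: "\<And>n::nat. finite_functional (F n)"
    and lim: "\<And>\<omega>. \<omega> \<in> C0 \<Longrightarrow> (\<lambda>n. F n \<omega>) \<longlonglongrightarrow> X \<omega>"
    unfolding limit_functional_def by blast
  have "(\<lambda>n. CLINT w|M. iexp (F n (\<lambda>t. B t w))) \<longlonglongrightarrow> (CLINT w|M. iexp (X (\<lambda>t. B t w)))"
    using lim M(2) gaussian_rv_finite_functional[OF M(1) F]
    by (intro char_limit[OF fbm_prob_space[OF M(1)]]) (auto simp: gaussian_rv_def)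
  moreover have "(\<lambda>n. CLINT w|N. iexp (F n (\<lambda>t. B' t w))) \<longlonglongrightarrow> (CLINT w|N. iexp (X (\<lambda>t. B' t w)))"
    using lim N(2) gaussian_rv_finite_functional[OF N(1) F]
    by (intro char_limit[OF fbm_prob_space[OF N(1)]]) (auto simp: gaussian_rv_def)
  ultimately show ?thesis
    unfolding char_finite_functional_cong[OF M(1) N(1) F] by (rule LIMSEQ_unique)
qed

text \<open>
  Two fractional Brownian motions with paths in \<open>C0\<close> give the same joint law to any finite family
  of limit functionals.
\<close>

lemma law_limit_functionals_cong:
  assumes M: "two_sided_fbm H M B" "\<And>w. w \<in> space M \<Longrightarrow> (\<lambda>t. B t w) \<in> C0"
    and N: "two_sided_fbm H N B'" "\<And>w. w \<in> space N \<Longrightarrow> (\<lambda>t. B' t w) \<in> C0"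
    and "finite J" and X: "\<And>j. j \<in> J \<Longrightarrow> limit_functional (X j)"
  shows "distr M (PiM J (\<lambda>_. borel)) (\<lambda>w. \<lambda>j\<in>J. X j (\<lambda>t. B t w)) =
    distr N (PiM J (\<lambda>_. borel)) (\<lambda>w. \<lambda>j\<in>J. X j (\<lambda>t. B' t w))"
proof (rule Cramer_Wold[OF fbm_prob_space[OF M(1)] fbm_prob_space[OF N(1)] \<open>finite J\<close>])
  fix a
  show "(CLINT w|M. iexp (\<Sum>j\<in>J. a j * X j (\<lambda>t. B t w))) = (CLINT w|N. iexp (\<Sum>j\<in>J. a j * X j (\<lambda>t. B' t w)))"
    using char_limit_functional_cong[OF M N limit_functional_lincomb, of J X a] X by blast
qed (auto intro!: measurable_limit_functional[OF M] measurable_limit_functional[OF N] X)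

section \<open>The error process and its increments\<close>

text \<open>
  With an antiderivative \<open>F\<close> of the path, both integrals equal
  \<open>(F (t + \<delta>) - F t - F \<delta> + F 0) / \<delta>\<close>, up to the common term \<open>- \<omega> t\<close>.  This moves the
  dependence on \<open>t\<close> from the domain of integration to the integrand.
\<close>

lemma error_process_eq_integral:
  assumes "0 < \<delta>" "0 \<le> t" and \<omega>: "continuous_on UNIV \<omega>"
  shows "error_process \<delta> t \<omega> = integral {0..1} (\<lambda>u. \<omega> (t + \<delta> * u) - \<omega> (\<delta> * u) - \<omega> t)"
proof -
  \<comment> \<open>The interval is enlarged on both sides so that derivatives on \<open>{0..t + \<delta>}\<close> are two-sided.\<close>
  obtain F where F: "\<And>x. x \<in> {-1..t + \<delta> + 1} \<Longrightarrow>
      (F has_vector_derivative \<omega> x) (at x within {-1..t + \<delta> + 1})"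
    using antiderivative_continuous[of "-1" "t + \<delta> + 1" \<omega>] \<omega> continuous_on_subset by blast
  have F': "(F has_field_derivative \<omega> x) (at x)" if "0 \<le> x" "x \<le> t + \<delta>" for x
    using F[of x] that at_within_Icc_at[of "-1" x "t + \<delta> + 1"]
    by (simp add: has_real_derivative_iff_has_vector_derivative)
  have chain: "((\<lambda>u. F (a + b * u)) has_vector_derivative \<omega> (a + b * x) * b) (at x within S)"
    if "0 \<le> a + b * x" "a + b * x \<le> t + \<delta>" for a b x S
    unfolding has_real_derivative_iff_has_vector_derivative[symmetric]
    by (rule DERIV_chain2[where f = F and g = "\<lambda>u. a + b * u", OF F'[OF that]])
       (auto intro!: derivative_eq_intros)
  have FTC: "((\<lambda>x. \<omega> (a + b * x) * b) has_integral F (a + b * r) - F a) {0..r}"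
    if "0 \<le> r" "0 \<le> a" "0 \<le> b" "a + b * r \<le> t + \<delta>" for a b r
  proof -
    have "a + b * x \<le> t + \<delta>" if "0 \<le> x" "x \<le> r" for x
      using that \<open>0 \<le> b\<close> \<open>a + b * r \<le> t + \<delta>\<close> mult_left_mono[of x r b] by linarith
    then have "((\<lambda>x. \<omega> (a + b * x) * b) has_integral F (a + b * r) - F (a + b * 0)) {0..r}"
      using that by (intro fundamental_theorem_of_calculus chain) auto
    then show ?thesis by simp
  qed
  define c where "c = 1 / \<delta>"
  have "((\<lambda>s. c * (\<omega> (\<delta> + s) - \<omega> s)) has_integral c * ((F (\<delta> + t) - F \<delta>) - (F t - F 0))) {0..t}"
    using FTC[of t \<delta> 1] FTC[of t 0 1] assms by (intro has_integral_mult_right has_integral_diff) auto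
  then have 1: "integral {0..t} (\<lambda>s. noise \<delta> (wiener_shift s \<omega>)) =
      c * ((F (\<delta> + t) - F \<delta>) - (F t - F 0))"
    unfolding noise_def wiener_shift_def c_def[symmetric] by (rule integral_unique)
  have "((\<lambda>u. c * (\<omega> (t + \<delta> * u) * \<delta> - \<omega> (\<delta> * u) * \<delta>)) has_integral
      c * ((F (t + \<delta>) - F t) - (F \<delta> - F 0))) {0..1}"
    using FTC[of 1 t \<delta>] FTC[of 1 0 \<delta>] assms by (intro has_integral_mult_right has_integral_diff) auto
  then have "((\<lambda>u. \<omega> (t + \<delta> * u) - \<omega> (\<delta> * u)) has_integral
      c * ((F (t + \<delta>) - F t) - (F \<delta> - F 0))) {0..1}"
    using assms by (simp add: c_def flip: left_diff_distrib)
  then have "((\<lambda>u. \<omega> (t + \<delta> * u) - \<omega> (\<delta> * u) - \<omega> t) has_integral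
      c * ((F (t + \<delta>) - F t) - (F \<delta> - F 0)) - \<omega> t) {0..1}"
    using has_integral_diff[OF _ has_integral_const_real[of "\<omega> t" 0 1]] by simp
  then show ?thesis
    unfolding error_process_def 1 by (simp add: integral_unique algebra_simps)
qed

text \<open>
  The error process is the mean of these increments over \<open>u\<close> in the unit interval, see
  \<open>error_process_eq_integral\<close>.
\<close>

definition error_increment :: "real \<Rightarrow> real \<Rightarrow> real \<Rightarrow> (real \<Rightarrow> real) \<Rightarrow> real" where
  "error_increment \<delta> t u \<omega> = \<omega> (t + \<delta> * u) - \<omega> (\<delta> * u) - \<omega> t"

text \<open>
  The left Riemann sum with \<open>n\<close> terms of that mean.  For \<open>n = 0\<close> it is \<open>0\<close>.
\<close>

definition error_riemann :: "real \<Rightarrow> real \<Rightarrow> nat \<Rightarrow> (real \<Rightarrow> real) \<Rightarrow> real" where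
  "error_riemann \<delta> t n \<omega> = (\<Sum>i<n. error_increment \<delta> t (real i / real n) \<omega>) / real n"

lemma finite_functional_error_increment: "finite_functional (error_increment \<delta> t u)"
  unfolding error_increment_def[abs_def] by (intro finite_functional_intros)

lemma finite_functional_error_riemann: "finite_functional (error_riemann \<delta> t n)"
proof -
  have "finite_functional (\<lambda>\<omega>. 1 / real n * (\<Sum>i<n. error_increment \<delta> t (real i / real n) \<omega>))"
    by (intro finite_functional_intros finite_functional_error_increment)
  then show ?thesis
    by (simp add: error_riemann_def[abs_def])
qed

lemma error_riemann_tendsto:
  assumes "0 < \<delta>" "0 \<le> t" "\<omega> \<in> C0"
  shows "(\<lambda>n. error_riemann \<delta> t n \<omega>) \<longlonglongrightarrow> error_process \<delta> t \<omega>"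
proof -
  have \<omega>: "continuous_on UNIV \<omega>"
    using assms(3) by (simp add: C0_def)
  show ?thesis
    unfolding error_riemann_def error_increment_def error_process_eq_integral[OF assms(1,2) \<omega>]
    by (intro riemann_sum_tendsto continuous_intros continuous_on_compose2[OF \<omega>]) auto
qed

lemma limit_functional_error_process:
  assumes "0 < \<delta>" "0 \<le> t"
  shows "limit_functional (error_process \<delta> t)"
  unfolding limit_functional_def
  using finite_functional_error_riemann error_riemann_tendsto[OF assms] by blast

lemma wiener_shift_C0: "\<omega> \<in> C0 \<Longrightarrow> wiener_shift h \<omega> \<in> C0"
  by (auto simp: C0_def wiener_shift_def intro!: continuous_intros continuous_on_compose2[of UNIV \<omega>])

lemma error_process_zero: "\<omega> \<in> C0 \<Longrightarrow> error_process \<delta> 0 \<omega> = 0"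
  by (simp add: error_process_def C0_def)

text \<open>
  An increment of the error process is the error process of the shifted path.  The identity is
  linear and holds for each Riemann sum, so it passes to the limit.
\<close>

lemma error_process_wiener_shift:
  assumes "0 < \<delta>" "0 \<le> t" "0 \<le> h" "\<omega> \<in> C0"
  shows "error_process \<delta> t (wiener_shift h \<omega>) = error_process \<delta> (t + h) \<omega> - error_process \<delta> h \<omega>"
proof -
  have "error_riemann \<delta> t n (wiener_shift h \<omega>) = error_riemann \<delta> (t + h) n \<omega> - error_riemann \<delta> h n \<omega>" for n
    unfolding error_riemann_def error_increment_def wiener_shift_def
    by (simp add: diff_divide_distrib[symmetric] sum_subtractf[symmetric] algebra_simps)
  then have "(\<lambda>n. error_riemann \<delta> t n (wiener_shift h \<omega>)) \<longlonglongrightarrow>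
      error_process \<delta> (t + h) \<omega> - error_process \<delta> h \<omega>"
    using assms by (auto intro!: tendsto_diff error_riemann_tendsto)
  moreover have "(\<lambda>n. error_riemann \<delta> t n (wiener_shift h \<omega>)) \<longlonglongrightarrow> error_process \<delta> t (wiener_shift h \<omega>)"
    using assms by (intro error_riemann_tendsto wiener_shift_C0)
  ultimately show ?thesis
    using LIMSEQ_unique by blast
qed

lemma stationary_increments_error_process:
  assumes "0 < \<delta>" and P: "fbm_law H P"
  shows "stationary_increments P (error_process \<delta>)"
proof -
  have sp: "space P = C0" and fbm: "two_sided_fbm H P (\<lambda>t \<omega>. \<omega> t)"
    using P by (auto simp: fbm_law_def)
  have fbm': "two_sided_fbm H P (\<lambda>t \<omega>. wiener_shift h \<omega> t)" for h
    using two_sided_fbm_shift[OF fbm, of h] by (simp add: wiener_shift_def)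
  show ?thesis
    unfolding stationary_increments_def
  proof (intro conjI allI impI)
    fix t :: real assume "0 \<le> t"
    then show "error_process \<delta> t \<in> borel_measurable P"
      using measurable_limit_functional[OF fbm _ limit_functional_error_process[OF \<open>0 < \<delta>\<close>]] sp by simp
  next
    fix h :: real and J :: "real set" assume "0 \<le> h" and J: "finite J \<and> J \<subseteq> {0..}"
    have "distr P (PiM J (\<lambda>_. borel)) (\<lambda>\<omega>. \<lambda>t\<in>J. error_process \<delta> t (\<lambda>s. wiener_shift h \<omega> s)) =
        distr P (PiM J (\<lambda>_. borel)) (\<lambda>\<omega>. \<lambda>t\<in>J. error_process \<delta> t (\<lambda>s. \<omega> s))"
      using J sp \<open>0 < \<delta>\<close>
      by (intro law_limit_functionals_cong[OF fbm' _ fbm] limit_functional_error_process wiener_shift_C0) auto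
    moreover have "distr P (PiM J (\<lambda>_. borel)) (\<lambda>\<omega>. \<lambda>t\<in>J. error_process \<delta> t (\<lambda>s. wiener_shift h \<omega> s)) =
        distr P (PiM J (\<lambda>_. borel)) (\<lambda>\<omega>. \<lambda>t\<in>J. error_process \<delta> (t + h) \<omega> - error_process \<delta> h \<omega>)"
      using J sp \<open>0 < \<delta>\<close> \<open>0 \<le> h\<close>
      by (intro distr_cong refl restrict_ext) (auto simp: error_process_wiener_shift)
    moreover have "distr P (PiM J (\<lambda>_. borel)) (\<lambda>\<omega>. \<lambda>t\<in>J. error_process \<delta> t (\<lambda>s. \<omega> s)) =
        distr P (PiM J (\<lambda>_. borel)) (\<lambda>\<omega>. \<lambda>t\<in>J. error_process \<delta> t \<omega> - error_process \<delta> 0 \<omega>)"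
      using sp by (intro distr_cong refl restrict_ext) (auto simp: error_process_zero)
    ultimately show "distr P (PiM J (\<lambda>_. borel)) (\<lambda>\<omega>. \<lambda>t\<in>J. error_process \<delta> (t + h) \<omega> - error_process \<delta> h \<omega>) =
        distr P (PiM J (\<lambda>_. borel)) (\<lambda>\<omega>. \<lambda>t\<in>J. error_process \<delta> t \<omega> - error_process \<delta> 0 \<omega>)"
      by simp
  qed
qed

section \<open>The variance of the error\<close>

text \<open>
  The integrand of \<open>Theta H x\<close>, as a function of \<open>u\<close> and \<open>s\<close>.
\<close>

definition Theta_integrand :: "real \<Rightarrow> real \<Rightarrow> real \<Rightarrow> real \<Rightarrow> real" where
  "Theta_integrand H x u s = x powr (2 * H) + 2 * u powr (2 * H) + \<bar>s - u + x\<bar> powr (2 * H)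
     - (u + x) powr (2 * H) - \<bar>u - x\<bar> powr (2 * H) - \<bar>u - s\<bar> powr (2 * H)"

lemma fbm_cov_scale:
  assumes "0 < \<delta>"
  shows "fbm_cov H (\<delta> * s) (\<delta> * t) = \<delta> powr (2 * H) * fbm_cov H s t"
proof -
  have q: "\<bar>\<delta> * z\<bar> powr (2 * H) = \<delta> powr (2 * H) * \<bar>z\<bar> powr (2 * H)" for z
    using assms by (simp add: abs_mult powr_mult)
  show ?thesis
    unfolding fbm_cov_def right_diff_distrib[symmetric] q by argo
qed

text \<open>
  The integrand of \<open>Theta\<close> is not symmetric in \<open>u\<close> and \<open>s\<close>, so the covariance is its symmetrization;
  the difference disappears in the double sum.
\<close>

lemma error_increment_covariance:
  assumes fbm: "two_sided_fbm H M B" and "0 < \<delta>" "0 \<le> x" "0 \<le> u" "0 \<le> s"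
  shows "(LINT w|M. error_increment \<delta> (\<delta> * x) u (\<lambda>t. B t w) * error_increment \<delta> (\<delta> * x) s (\<lambda>t. B t w)) =
    \<delta> powr (2 * H) * ((Theta_integrand H x u s + Theta_integrand H x s u) / 2)"
proof -
  define q where "q z = \<bar>z\<bar> powr (2 * H)" for z :: real
  have q: "q (- z) = q z" for z by (simp add: q_def)
  have cov: "fbm_cov H a b = (q a + q b - q (b - a)) / 2" for a b
    by (simp add: fbm_cov_def q_def)
  have Th: "Theta_integrand H x u s = q x + 2 * q u + q (s - u + x) - q (x + u) - q (u - x) - q (u - s)"
    if "0 \<le> u" for u s
    using that \<open>0 \<le> x\<close> by (simp add: Theta_integrand_def q_def add.commute[of u x])
  let ?E = "\<lambda>a b. LINT w|M. B (\<delta> * a) w * B (\<delta> * b) w"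
  have "(LINT w|M. error_increment \<delta> (\<delta> * x) u (\<lambda>t. B t w) * error_increment \<delta> (\<delta> * x) s (\<lambda>t. B t w)) =
     ?E (x + u) (x + s) - ?E (x + u) s - ?E (x + u) x - ?E u (x + s) + ?E u s + ?E u x
       - ?E x (x + s) + ?E x s + ?E x x"
    unfolding error_increment_def distrib_left[symmetric] left_diff_distrib right_diff_distrib
    by (simp add: integrable_fbm_mult[OF fbm])
  also have "\<dots> = \<delta> powr (2 * H) * (fbm_cov H (x + u) (x + s) - fbm_cov H (x + u) s - fbm_cov H (x + u) x
       - fbm_cov H u (x + s) + fbm_cov H u s + fbm_cov H u x
       - fbm_cov H x (x + s) + fbm_cov H x s + fbm_cov H x x)"
    unfolding expectation_fbm_mult[OF fbm] fbm_cov_scale[OF \<open>0 < \<delta>\<close>] by (simp add: algebra_simps)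
  also have "fbm_cov H (x + u) (x + s) - fbm_cov H (x + u) s - fbm_cov H (x + u) x
       - fbm_cov H u (x + s) + fbm_cov H u s + fbm_cov H u x
       - fbm_cov H x (x + s) + fbm_cov H x s + fbm_cov H x x =
      (Theta_integrand H x u s + Theta_integrand H x s u) / 2"
  proof -
    have "s - (x + u) = - (u - s + x)" "x - u = - (u - x)" "x - s = - (s - x)" "x - (x + u) = - u"
      "u - s = - (s - u)"
      by simp_all
    then have sym: "q (s - (x + u)) = q (u - s + x)" "q (x - u) = q (u - x)" "q (x - s) = q (s - x)"
      "q (x - (x + u)) = q u" "q (u - s) = q (s - u)"
      by (simp_all only: q)
    have arg: "x + s - u = s - u + x" "x + s - (x + u) = s - u" "x + s - x = s" "x - x = 0"
      by simp_all
    have "q 0 = 0" by (simp add: q_def)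
    then show ?thesis
      unfolding cov Th[OF \<open>0 \<le> u\<close>] Th[OF \<open>0 \<le> s\<close>] arg sym by argo
  qed
  finally show ?thesis .
qed

lemma Theta_riemann_tendsto:
  assumes "0 < H" "0 \<le> x"
  shows "(\<lambda>n. (\<Sum>i<n. \<Sum>j<n. Theta_integrand H x (real i / real n) (real j / real n)) / (real n)\<^sup>2)
    \<longlonglongrightarrow> Theta H x"
proof -
  have "continuous_on ({0..1} \<times> {0..1}) (\<lambda>(u, s). Theta_integrand H x u s)"
  proof -
    have powr: "continuous_on S (\<lambda>z. f z powr (2 * H))"
      if "continuous_on S f" "\<And>z. z \<in> S \<Longrightarrow> 0 \<le> f z" for S and f :: "real \<times> real \<Rightarrow> real"
      using that \<open>0 < H\<close> by (intro continuous_on_powr' continuous_on_const) auto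
    show ?thesis
      unfolding Theta_integrand_def case_prod_beta using \<open>0 \<le> x\<close>
      by (intro continuous_on_diff continuous_on_add continuous_on_mult continuous_on_const
          continuous_on_rabs continuous_on_fst continuous_on_snd continuous_on_id powr) auto
  qed
  from double_riemann_sum_tendsto[OF this] show ?thesis
    by (simp add: Theta_def Theta_integrand_def)
qed

lemma error_riemann_second_moment:
  assumes fbm: "two_sided_fbm H M B" and "0 < \<delta>" "0 \<le> x"
  shows "(LINT w|M. (error_riemann \<delta> (\<delta> * x) n (\<lambda>t. B t w))\<^sup>2) = \<delta> powr (2 * H) *
    ((\<Sum>i<n. \<Sum>j<n. Theta_integrand H x (real i / real n) (real j / real n)) / (real n)\<^sup>2)"
proof -
  let ?A = "\<lambda>i w. error_increment \<delta> (\<delta> * x) (real i / real n) (\<lambda>t. B t w)"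
  let ?g = "\<lambda>i j. Theta_integrand H x (real i / real n) (real j / real n)"
  have "(LINT w|M. (error_riemann \<delta> (\<delta> * x) n (\<lambda>t. B t w))\<^sup>2) =
      (LINT w|M. (\<Sum>i<n. \<Sum>j<n. ?A i w * ?A j w) / (real n)\<^sup>2)"
    unfolding error_riemann_def by (simp add: power2_eq_square sum_product)
  also have "\<dots> = (\<Sum>i<n. \<Sum>j<n. (LINT w|M. ?A i w * ?A j w)) / (real n)\<^sup>2"
    using integrable_finite_functional_mult[OF fbm finite_functional_error_increment finite_functional_error_increment]
    by simp
  also have "\<dots> = (\<Sum>i<n. \<Sum>j<n. \<delta> powr (2 * H) * ((?g i j + ?g j i) / 2)) / (real n)\<^sup>2"
    using assms by (simp add: error_increment_covariance)
  also have "(\<Sum>i<n. \<Sum>j<n. \<delta> powr (2 * H) * ((?g i j + ?g j i) / 2)) =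
      \<delta> powr (2 * H) * (((\<Sum>i<n. \<Sum>j<n. ?g i j) + (\<Sum>i<n. \<Sum>j<n. ?g j i)) / 2)"
    by (simp add: sum_distrib_left[symmetric] sum_divide_distrib[symmetric] sum.distrib)
  also have "(\<Sum>i<n. \<Sum>j<n. ?g j i) = (\<Sum>i<n. \<Sum>j<n. ?g i j)"
    by (rule sum.swap)
  finally show ?thesis by simp
qed

theorem proposition3p1:
  fixes H \<delta> :: real and P :: "(real \<Rightarrow> real) measure"
  assumes "0 < H" and "H < 1" and "\<delta> > 0" and "fbm_law H P"
  shows "stationary_increments P (error_process \<delta>) \<and>
    (\<forall>p::real. \<forall>t::real. p \<ge> 1 \<and> t \<ge> 0 \<longrightarrow>
       integrable P (\<lambda>\<omega>. \<bar>error_process \<delta> t \<omega>\<bar> powr p) \<and>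
       integral\<^sup>L P (\<lambda>\<omega>. \<bar>error_process \<delta> t \<omega>\<bar> powr p) =
         2 powr (p / 2) * Gamma ((p + 1) / 2) / sqrt pi
           * \<delta> powr (p * H) * Theta H (t / \<delta>) powr (p / 2))"
proof (rule conjI)
  show "stationary_increments P (error_process \<delta>)"
    using assms(3,4) by (rule stationary_increments_error_process)
  have sp: "space P = C0" and fbm: "two_sided_fbm H P (\<lambda>t \<omega>. \<omega> t)"
    using assms(4) by (auto simp: fbm_law_def)
  show "\<forall>p::real. \<forall>t::real. p \<ge> 1 \<and> t \<ge> 0 \<longrightarrow>
       integrable P (\<lambda>\<omega>. \<bar>error_process \<delta> t \<omega>\<bar> powr p) \<and>
       integral\<^sup>L P (\<lambda>\<omega>. \<bar>error_process \<delta> t \<omega>\<bar> powr p) =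
         2 powr (p / 2) * Gamma ((p + 1) / 2) / sqrt pi
           * \<delta> powr (p * H) * Theta H (t / \<delta>) powr (p / 2)"
  proof (intro allI impI)
    fix p t :: real assume "p \<ge> 1 \<and> t \<ge> 0"
    then have "1 \<le> p" "0 \<le> t" by auto
    define x where "x = t / \<delta>"
    have x: "0 \<le> x" "t = \<delta> * x"
      using \<open>0 \<le> t\<close> \<open>\<delta> > 0\<close> by (auto simp: x_def)
    define v where "v = \<delta> powr (2 * H) * Theta H x"
    let ?v = "\<lambda>n. LINT \<omega>|P. (error_riemann \<delta> t n \<omega>)\<^sup>2"
    have v: "?v \<longlonglongrightarrow> v"
      unfolding v_def x(2) error_riemann_second_moment[OF fbm \<open>\<delta> > 0\<close> \<open>0 \<le> x\<close>]
      by (intro tendsto_mult_left Theta_riemann_tendsto assms x)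
    then have "0 \<le> v"
      by (rule LIMSEQ_le_const) simp
    have meas: "error_process \<delta> t \<in> borel_measurable P"
      using measurable_limit_functional[OF fbm _ limit_functional_error_process[OF \<open>\<delta> > 0\<close> \<open>0 \<le> t\<close>]] sp by simp
    \<comment> \<open>The error at time \<open>t\<close> is centered normal with variance \<open>v\<close>.\<close>
    have "(CLINT \<omega>|P. iexp (s * error_process \<delta> t \<omega>)) = exp (- s\<^sup>2 * v / 2)" for s
    proof (rule LIMSEQ_unique)
      show "(\<lambda>n. CLINT \<omega>|P. iexp (s * error_riemann \<delta> t n \<omega>)) \<longlonglongrightarrow>
          (CLINT \<omega>|P. iexp (s * error_process \<delta> t \<omega>))"
      proof (rule char_limit[OF fbm_prob_space[OF fbm]])
        show "(\<lambda>\<omega>. s * error_riemann \<delta> t n \<omega>) \<in> borel_measurable P" for n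
          using gaussian_rv_finite_functional[OF fbm finite_functional_error_riemann, of \<delta> t n]
          by (intro borel_measurable_times borel_measurable_const) (simp add: gaussian_rv_def)
      qed (use sp \<open>\<delta> > 0\<close> \<open>0 \<le> t\<close> in \<open>auto intro!: tendsto_mult_left error_riemann_tendsto\<close>)
      show "(\<lambda>n. CLINT \<omega>|P. iexp (s * error_riemann \<delta> t n \<omega>)) \<longlonglongrightarrow> exp (- s\<^sup>2 * v / 2)"
        unfolding char_finite_functional[OF fbm finite_functional_error_riemann]
        by (intro tendsto_intros v) auto
    qed
    note moment = abs_moment_centered_normal_char[OF fbm_prob_space[OF fbm] meas \<open>0 \<le> v\<close> _ this, of p]
    have "0 \<le> Theta H x"
      using \<open>0 \<le> v\<close> \<open>\<delta> > 0\<close> by (simp add: v_def zero_le_mult_iff)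
    then have "v powr (p / 2) = \<delta> powr (p * H) * Theta H (t / \<delta>) powr (p / 2)"
      using \<open>\<delta> > 0\<close> by (simp add: v_def x_def powr_mult powr_powr mult.commute)
    then show "integrable P (\<lambda>\<omega>. \<bar>error_process \<delta> t \<omega>\<bar> powr p) \<and>
       integral\<^sup>L P (\<lambda>\<omega>. \<bar>error_process \<delta> t \<omega>\<bar> powr p) =
         2 powr (p / 2) * Gamma ((p + 1) / 2) / sqrt pi
           * \<delta> powr (p * H) * Theta H (t / \<delta>) powr (p / 2)"
      using moment \<open>1 \<le> p\<close> by (simp add: mult.assoc)
  qed
qed

end
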